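(* Let $1<p<q$ and let $Y$ be a reflexive asymptotically $q$-uniformly smooth Banach space. (i) If a Banach space $X$ contains a sequence which is asymptotically $\ell_1$, then $\alpha_Y(X)\le 1/q$. (ii) If $X$ is an infinite dimensional Banach space with the $p$-co-Banach-Saks property and not containing $\ell_1$, then $\alpha_Y(X)\le p/q$. In either case, $X$ does not coarse Lipschitz embed into $Y$.
   Context: A sequence $(x_n)$ in $X$ is asymptotically $\ell_1$ if there is $L>0$ such that for every $m$ there is $k$ such that for all $k\le n_1<\dots<n_m$, $(x_{n_j})_{j=1}^m$ is $L$-equivalent to the first $m$ unit vectors of $\ell_1$. $X$ has the $p$-co-Banach-Saks property if every semi-normalized weakly null sequence $(x_n)$ has a subsequence $(x_{n_j})$ and $c>0$ with $\|x_{n_{j_1}}+\dots+x_{n_{j_k}}\|\ge ck^{1/p}$ for all $k\le j_1<\dots<j_k$. $Y$ is asymptotically $q$-uniformly smooth if $\overline\rho_Y(t)\le Ct^q$ on $[0,1]$ for some $C$, where $\overline{\rho}_Y(t)=\sup_{x\in\partial B_Y}\inf_{\dim(Y/E)<\infty}\sup_{h\in\partial B_E}\|x+th\|-1$. For $f:X\to Y$, $\omega_f(t)=\sup\{\|f(x)-f(y)\|:\|x-y\|\le t\}$, $\rho_f(t)=\inf\{\|f(x)-f(y)\|:\|x-y\|\ge t\}$; coarse embedding: $\omega_f<\infty$ and $\rho_f(t)\to\infty$; coarse Lipschitz embedding: $\omega_f(t)\le Lt+L$, $\rho_f(t)\ge L^{-1}t-L$ for some $L$. The compression exponent $\alpha_Y(X)$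 is the supremum of $\alpha>0$ for which there exist a coarse embedding $f:X\to Y$ and $L>0$ with $\|f(x)-f(y)\|\ge L^{-1}\|x-y\|^\alpha-L$ for all $x,y$ ($0$ if none). *)

theory Defs
  imports "HOL-Analysis.Analysis"
begin

definition reflexive_space :: "'b::real_normed_vector itself \<Rightarrow> bool" where
  "reflexive_space _ \<longleftrightarrow>
     (\<forall>\<phi> :: ('b \<Rightarrow>\<^sub>L real) \<Rightarrow>\<^sub>L real. \<exists>y::'b. \<forall>g. blinfun_apply \<phi> g = blinfun_apply g y)"

definition infinite_dimensional :: "'a::real_vector itself \<Rightarrow> bool" where
  "infinite_dimensional _ \<longleftrightarrow> \<not> (\<exists>S::'a set. finite S \<and> span S = UNIV)"

definition finite_codim :: "'b::real_vector set \<Rightarrow> bool" where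
  "finite_codim E \<longleftrightarrow> subspace E \<and> (\<exists>S. finite S \<and> span (E \<union> S) = UNIV)"

definition asymp_smooth_modulus :: "'b::real_normed_vector itself \<Rightarrow> real \<Rightarrow> ereal" where
  "asymp_smooth_modulus _ t =
     (SUP x\<in>sphere (0::'b) 1. INF E\<in>{E::'b set. finite_codim E}.
        SUP h\<in>E \<inter> sphere 0 1. ereal (norm (x + t *\<^sub>R h) - 1))"

definition asymp_q_uniformly_smooth :: "real \<Rightarrow> 'b::real_normed_vector itself \<Rightarrow> bool" where
  "asymp_q_uniformly_smooth q T \<longleftrightarrow>
     (\<exists>C::real. \<forall>t\<in>{0..1}. asymp_smooth_modulus T t \<le> ereal (C * t powr q))"

definition semi_normalized :: "(nat \<Rightarrow> 'a::real_normed_vector) \<Rightarrow> bool" where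
  "semi_normalized x \<longleftrightarrow> (\<exists>a b. 0 < a \<and> (\<forall>n. a \<le> norm (x n) \<and> norm (x n) \<le> b))"

definition weakly_null :: "(nat \<Rightarrow> 'a::real_normed_vector) \<Rightarrow> bool" where
  "weakly_null x \<longleftrightarrow> (\<forall>g :: 'a \<Rightarrow>\<^sub>L real. (\<lambda>n. blinfun_apply g (x n)) \<longlonglongrightarrow> 0)"

text \<open>Asymptotically l1 sequence. Index sequences n_1 < ... < n_m are
  represented by functions on {..<m}; (x_{n_j}) is L-equivalent to the unit vector
  basis of l1^m means L^{-1} sum|a_j| \<le> ||sum a_j x_{n_j}|| \<le> L sum |a_j|.\<close>
definition asymp_l1_seq :: "(nat \<Rightarrow> 'a::real_normed_vector) \<Rightarrow> bool" where
  "asymp_l1_seq x \<longleftrightarrow>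
     (\<exists>L>0. \<forall>m. \<exists>k. \<forall>n::nat \<Rightarrow> nat.
        ((\<forall>j<m. k \<le> n j) \<and> (\<forall>j. Suc j < m \<longrightarrow> n j < n (Suc j))) \<longrightarrow>
        (\<forall>a::nat \<Rightarrow> real.
           (1 / L) * (\<Sum>j<m. \<bar>a j\<bar>) \<le> norm (\<Sum>j<m. a j *\<^sub>R x (n j)) \<and>
           norm (\<Sum>j<m. a j *\<^sub>R x (n j)) \<le> L * (\<Sum>j<m. \<bar>a j\<bar>)))"

text \<open>p-co-Banach-Saks property. The subsequence is x o \<sigma>; indices j_1<...<j_k
  with k \<le> j_1 are represented by J on {..<k}.\<close>
definition co_banach_saks :: "real \<Rightarrow> 'a::real_normed_vector itself \<Rightarrow> bool" where
  "co_banach_saks p _ \<longleftrightarrow>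
     (\<forall>x::nat \<Rightarrow> 'a. semi_normalized x \<and> weakly_null x \<longrightarrow>
        (\<exists>\<sigma>::nat \<Rightarrow> nat. strict_mono \<sigma> \<and> (\<exists>c>0. \<forall>k. \<forall>J::nat \<Rightarrow> nat.
           ((\<forall>i<k. k \<le> J i) \<and> (\<forall>i. Suc i < k \<longrightarrow> J i < J (Suc i))) \<longrightarrow>
           norm (\<Sum>i<k. x (\<sigma> (J i))) \<ge> c * real k powr (1 / p))))"

definition l1_space :: "(nat \<Rightarrow> real) set" where
  "l1_space = {a. summable (\<lambda>n. \<bar>a n\<bar>)}"

definition l1_norm :: "(nat \<Rightarrow> real) \<Rightarrow> real" where
  "l1_norm a = (\<Sum>n. \<bar>a n\<bar>)"

definition contains_l1 :: "'a::real_normed_vector itself \<Rightarrow> bool" where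
  "contains_l1 _ \<longleftrightarrow>
     (\<exists>T :: (nat \<Rightarrow> real) \<Rightarrow> 'a. \<exists>C>0.
        (\<forall>a\<in>l1_space. \<forall>b\<in>l1_space. T (\<lambda>n. a n + b n) = T a + T b) \<and>
        (\<forall>a\<in>l1_space. \<forall>c. T (\<lambda>n. c * a n) = c *\<^sub>R T a) \<and>
        (\<forall>a\<in>l1_space. (1 / C) * l1_norm a \<le> norm (T a) \<and> norm (T a) \<le> C * l1_norm a))"

definition omega_f :: "('a::real_normed_vector \<Rightarrow> 'b::real_normed_vector) \<Rightarrow> real \<Rightarrow> ereal" where
  "omega_f f t = (SUP p\<in>{(x, y). norm (x - y) \<le> t}. ereal (norm (f (fst p) - f (snd p))))"

definition rho_f :: "('a::real_normed_vector \<Rightarrow> 'b::real_normed_vector) \<Rightarrow> real \<Rightarrow> ereal" where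
  "rho_f f t = (INF p\<in>{(x, y). norm (x - y) \<ge> t}. ereal (norm (f (fst p) - f (snd p))))"

definition coarse_embedding :: "('a::real_normed_vector \<Rightarrow> 'b::real_normed_vector) \<Rightarrow> bool" where
  "coarse_embedding f \<longleftrightarrow> (\<forall>t. omega_f f t < \<infinity>) \<and> ((\<lambda>t. rho_f f t) \<longlongrightarrow> \<infinity>) at_top"

definition coarse_lipschitz_embedding :: "('a::real_normed_vector \<Rightarrow> 'b::real_normed_vector) \<Rightarrow> bool" where
  "coarse_lipschitz_embedding f \<longleftrightarrow>
     (\<exists>L>0. \<forall>t\<ge>0. omega_f f t \<le> ereal (L * t + L) \<and> rho_f f t \<ge> ereal (t / L - L))"

text \<open>Compression exponent alpha_Y(X); it is 0 if no admissible alpha exists.\<close>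
definition compression_exponent ::
    "'a::real_normed_vector itself \<Rightarrow> 'b::real_normed_vector itself \<Rightarrow> ereal" where
  "compression_exponent _ _ =
     Sup (insert 0 (ereal ` {\<alpha>::real. \<alpha> > 0 \<and>
        (\<exists>f::'a \<Rightarrow> 'b. coarse_embedding f \<and>
           (\<exists>L>0. \<forall>x y. norm (f x - f y) \<ge> norm (x - y) powr \<alpha> / L - L))}))"

end

theory Submission
  imports Defs
begin

text \<open>
  Fix a free ultrafilter on the natural numbers. By reflexivity bounded sequences in the target
  space have weak limits along it. Applied to the coordinates of a \<open>k\<close>-tuple from the last one
  on, this writes the value at a tuple of a map that moves by at most \<open>\<lambda>\<close> when one coordinate
  changes as a constant plus \<open>k\<close> successive weakly null increments of norm at most \<open>\<lambda>\<close>. Asymptotic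
  \<open>q\<close>-uniform smoothness makes the norm grow by a factor of at most \<open>1 + O(1/k)\<close> with each increment
  once it exceeds \<open>\<lambda> k\<^bsup>1/q\<^esup>\<close>, so on the tuples from a suitable infinite set of indices the map is
  within \<open>O(\<lambda> k\<^bsup>1/q\<^esup>)\<close> of a constant (Kalton and Randrianarivony).

  For a coarse embedding \<open>f\<close> and a bounded sequence \<open>x\<close> this is used for
  \<open>(n\<^sub>1, \<dots>, n\<^sub>k) \<mapsto> f (x\<^bsub>n\<^sub>1\<^esub> + \<dots> + x\<^bsub>n\<^sub>k\<^esub>)\<close>. For an asymptotically \<open>\<ell>\<^sub>1\<close> sequence two such sums can
  be at distance of order \<open>k\<close>, which gives (i). For (ii), take a bounded separated sequence, a common
  infinite index set for all \<open>k\<close>, and the differences \<open>z\<close> of consecutive terms along it. If \<open>z\<close> is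
  weakly null, the co-Banach-Saks property bounds sums of \<open>k\<close> differences below by a multiple of
  \<open>k\<^bsup>1/p\<^esup>\<close>; if not, some functional bounds them below by a multiple of \<open>k\<close> on a subsequence. This
  dichotomy replaces Rosenthal's \<open>\<ell>\<^sub>1\<close> theorem.
\<close>

section \<open>Ultrafilters\<close>

definition ultrafilter :: "'i filter \<Rightarrow> bool" where
  "ultrafilter U \<longleftrightarrow> U \<noteq> bot \<and> (\<forall>P. eventually P U \<or> eventually (\<lambda>x. \<not> P x) U)"

lemma ultrafilter_not_bot: "ultrafilter U \<Longrightarrow> U \<noteq> bot"
  by (simp add: ultrafilter_def)

text \<open>By Zorn's lemma for the reversed order there is a minimal proper filter below
  \<open>F\<close>. Restricting it to \<open>{x. P x}\<close> gives either \<open>bot\<close> or, by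
  minimality, the filter itself, so it decides every \<open>P\<close>.\<close>

lemma ultrafilter_exists:
  assumes "F \<noteq> (bot :: 'i filter)"
  obtains U where "ultrafilter U" "U \<le> F"
proof -
  let ?A = "{G. G \<noteq> bot \<and> G \<le> F}"
  have "\<exists>m\<in>?A. \<forall>a\<in>?A. m \<ge> a \<longrightarrow> a = m"
  proof (rule predicate_Zorn)
    show "partial_order_on ?A (relation_of (\<ge>) ?A)"
      by (rule partial_order_on_relation_ofI) auto
  next
    fix C assume C: "C \<in> Chains (relation_of (\<ge>) ?A)"
    then have CA: "C \<subseteq> ?A" by (rule Chains_relation_of)
    show "\<exists>u\<in>?A. \<forall>a\<in>C. a \<ge> u"
    proof (cases "C = {}")
      case True
      then show ?thesis using assms by auto
    next
      case False
      \<comment> \<open>A nonempty chain is directed downwards, so an event holding along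
        \<open>Inf C\<close> already holds along some member. This keeps \<open>Inf C\<close>
        proper.\<close>
      have "\<exists>x\<in>C. x \<le> inf G H" if "G \<in> C" "H \<in> C" for G H
      proof -
        have "G \<le> H \<or> H \<le> G"
          using C that by (auto simp: Chains_def relation_of_def)
        then show ?thesis using that by (auto intro: bexI[of _ G] bexI[of _ H])
      qed
      then have "\<not> eventually (\<lambda>_. False) (Inf C)"
        using CA by (subst eventually_Inf_base[OF False]) (auto simp: trivial_limit_def)
      then have "Inf C \<noteq> bot" by (simp add: trivial_limit_def)
      moreover obtain G where "G \<in> C" using False by blast
      then have "Inf C \<le> F" using CA by (intro Inf_lower2[of G]) auto
      ultimately show ?thesis by (intro bexI[of _ "Inf C"] ballI Inf_lower) auto
    qed
  qed
  then obtain U where U: "U \<noteq> bot" "U \<le> F"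
    and min: "\<And>G. G \<noteq> bot \<Longrightarrow> G \<le> U \<Longrightarrow> G = U"
    using order_trans by blast
  have "eventually P U \<or> eventually (\<lambda>x. \<not> P x) U" for P
  proof (rule disjCI)
    assume "\<not> eventually (\<lambda>x. \<not> P x) U"
    then have "inf U (principal {x. P x}) \<noteq> bot"
      by (auto simp: trivial_limit_def eventually_inf_principal)
    then have "inf U (principal {x. P x}) = U" by (intro min) auto
    then show "eventually P U"
      using eventually_inf_principal[of P U "{x. P x}"] by simp
  qed
  then show ?thesis using that U by (auto simp: ultrafilter_def)
qed

text \<open>Compactness of \<open>{-b..b}\<close> gives the image filter a cluster point, and for
  the image of an ultrafilter a cluster point is a limit.\<close>

lemma ultrafilter_tendsto_bounded:
  fixes f :: "'i \<Rightarrow> real"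
  assumes U: "ultrafilter U" and b: "\<And>n. \<bar>f n\<bar> \<le> b"
  obtains l where "(f \<longlongrightarrow> l) U"
proof -
  have "filtermap f U \<noteq> bot" "eventually (\<lambda>x. x \<in> {-b..b}) (filtermap f U)"
    using U b by (auto simp: ultrafilter_def filtermap_bot_iff eventually_filtermap abs_le_iff
        minus_le_iff)
  then obtain l where l: "inf (nhds l) (filtermap f U) \<noteq> bot"
    using compact_Icc[of "-b" b] unfolding compact_filter by blast
  have "(f \<longlongrightarrow> l) U"
  proof (rule topological_tendstoI)
    fix S assume S: "open S" "l \<in> S"
    show "eventually (\<lambda>x. f x \<in> S) U"
    proof (rule ccontr)
      assume "\<not> ?thesis"
      then have "eventually (\<lambda>x. f x \<notin> S) U" using U by (auto simp: ultrafilter_def)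
      then have "eventually (\<lambda>x. False) (inf (nhds l) (filtermap f U))"
        unfolding eventually_inf
        using S by (intro exI[of _ "\<lambda>x. x \<in> S"] exI[of _ "\<lambda>x. x \<notin> S"])
          (auto simp: eventually_filtermap intro: eventually_nhds_in_open)
      then show False using l by (simp add: trivial_limit_def)
    qed
  qed
  then show ?thesis using that by blast
qed

section \<open>Norming functionals\<close>

definition sublinear :: "('a::real_vector \<Rightarrow> real) \<Rightarrow> bool" where
  "sublinear p \<longleftrightarrow> (\<forall>x y. p (x + y) \<le> p x + p y) \<and> (\<forall>t x. t \<ge> 0 \<longrightarrow> p (t *\<^sub>R x) = t * p x)"

lemma sublinear_zero: "sublinear p \<Longrightarrow> p 0 = 0"
  unfolding sublinear_def by (metis scaleR_zero_left order_refl mult_zero_left)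

lemma sublinear_neg:
  assumes "sublinear p"
  shows "- p (- x) \<le> p x"
proof -
  have "p (x + (- x)) \<le> p x + p (- x)" using assms unfolding sublinear_def by blast
  then show ?thesis using sublinear_zero[OF assms] by simp
qed

text \<open>Subtracting as much of direction \<open>z\<close> as possible; a sublinear functional that is
  not changed by this for any \<open>z\<close> is linear.\<close>

definition shave :: "('a::real_vector \<Rightarrow> real) \<Rightarrow> 'a \<Rightarrow> 'a \<Rightarrow> real" where
  "shave p z y = (INF t\<in>{0..}. p (y + t *\<^sub>R z) - t * p z)"

text \<open>A lower bound independent of \<open>t\<close>, so that the real infimum in
  \<open>shave\<close> is a genuine one.\<close>

lemma shave_lower:
  assumes p: "sublinear p" and t: "t \<ge> 0"
  shows "- p (- y) \<le> p (y + t *\<^sub>R z) - t * p z"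
proof -
  have "t * p z = p (t *\<^sub>R z)" using p t by (simp add: sublinear_def)
  also have "\<dots> = p ((y + t *\<^sub>R z) + (- y))" by simp
  also have "\<dots> \<le> p (y + t *\<^sub>R z) + p (- y)" using p unfolding sublinear_def by blast
  finally show ?thesis by simp
qed

lemma shave_le:
  assumes p: "sublinear p" and t: "t \<ge> 0"
  shows "shave p z y \<le> p (y + t *\<^sub>R z) - t * p z"
  unfolding shave_def
  by (rule cINF_lower) (use t shave_lower[OF p] in \<open>auto intro!: bdd_belowI2\<close>)

lemma shave_greatest:
  assumes "\<And>t. t \<ge> 0 \<Longrightarrow> c \<le> p (y + t *\<^sub>R z) - t * p z"
  shows "c \<le> shave p z y"
  unfolding shave_def by (rule cINF_greatest) (use assms in auto)

lemma sublinear_shave: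
  assumes p: "sublinear p"
  shows "sublinear (shave p z)"
  unfolding sublinear_def
proof (intro conjI allI impI)
  fix x y
  have *: "shave p z (x + y) \<le> (p (x + s *\<^sub>R z) - s * p z) + (p (y + t *\<^sub>R z) - t * p z)"
    if "s \<ge> 0" "t \<ge> 0" for s t
  proof -
    have "shave p z (x + y) \<le> p (x + y + (s + t) *\<^sub>R z) - (s + t) * p z"
      by (rule shave_le[OF p]) (use that in simp)
    also have "x + y + (s + t) *\<^sub>R z = (x + s *\<^sub>R z) + (y + t *\<^sub>R z)"
      by (simp add: algebra_simps)
    also have "p \<dots> \<le> p (x + s *\<^sub>R z) + p (y + t *\<^sub>R z)" using p unfolding sublinear_def by blast
    finally show ?thesis by (simp add: algebra_simps)
  qed
  have "shave p z (x + y) - (p (x + s *\<^sub>R z) - s * p z) \<le> shave p z y" if "s \<ge> 0" for s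
    by (rule shave_greatest) (use *[OF that] in \<open>simp add: algebra_simps\<close>)
  then have "shave p z (x + y) - shave p z y \<le> shave p z x"
    by (intro shave_greatest) (simp add: algebra_simps)
  then show "shave p z (x + y) \<le> shave p z x + shave p z y" by simp
next
  fix t :: real and x assume "t \<ge> 0"
  have z: "shave p z 0 = 0"
  proof (rule antisym)
    show "shave p z 0 \<le> 0" using shave_le[OF p, of 0 z 0] sublinear_zero[OF p] by simp
    show "0 \<le> shave p z 0"
      by (rule shave_greatest) (use p in \<open>simp add: sublinear_def\<close>)
  qed
  \<comment> \<open>One inequality for all \<open>c > 0\<close> suffices: at \<open>1 / t\<close>
    and \<open>t *\<^sub>R x\<close> it yields the converse one.\<close>
  have le: "c * shave p z x \<le> shave p z (c *\<^sub>R x)" if c: "c > 0" for c x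
  proof (rule shave_greatest)
    fix s :: real assume s: "s \<ge> 0"
    have "shave p z x \<le> p (x + (s / c) *\<^sub>R z) - (s / c) * p z"
      by (rule shave_le[OF p]) (use s c in simp)
    then have "c * shave p z x \<le> c * p (x + (s / c) *\<^sub>R z) - s * p z"
      using c by (simp add: field_simps)
    also have "c * p (x + (s / c) *\<^sub>R z) = p (c *\<^sub>R (x + (s / c) *\<^sub>R z))"
      using p c by (simp add: sublinear_def)
    also have "c *\<^sub>R (x + (s / c) *\<^sub>R z) = c *\<^sub>R x + s *\<^sub>R z" using c by (simp add: scaleR_add_right)
    finally show "c * shave p z x \<le> p (c *\<^sub>R x + s *\<^sub>R z) - s * p z" .
  qed
  show "shave p z (t *\<^sub>R x) = t * shave p z x"
  proof (cases "t = 0")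
    case True
    then show ?thesis using z by simp
  next
    case False
    then have t: "t > 0" using \<open>t \<ge> 0\<close> by simp
    from le[of "1 / t" "t *\<^sub>R x"] t have "shave p z (t *\<^sub>R x) \<le> t * shave p z x"
      by (simp add: field_simps)
    with le[OF t, of x] show ?thesis by simp
  qed
qed

text \<open>Zorn's lemma again: the pointwise infimum of a chain is finite because every member lies
  above \<open>- p0 (- x)\<close>, and subadditive because any two members are comparable.\<close>

lemma minimal_sublinear_exists:
  assumes p0: "sublinear p0"
  obtains m where "sublinear m" "\<And>x. m x \<le> p0 x"
    "\<And>r. sublinear r \<Longrightarrow> (\<And>x. r x \<le> m x) \<Longrightarrow> r = m"
proof -
  let ?A = "{p. sublinear p \<and> p \<le> p0}"
  have "\<exists>m\<in>?A. \<forall>a\<in>?A. m \<ge> a \<longrightarrow> a = m"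
  proof (rule predicate_Zorn)
    show "partial_order_on ?A (relation_of (\<ge>) ?A)"
      by (rule partial_order_on_relation_ofI) auto
  next
    fix C assume C: "C \<in> Chains (relation_of (\<ge>) ?A)"
    then have CA: "C \<subseteq> ?A" by (rule Chains_relation_of)
    show "\<exists>u\<in>?A. \<forall>a\<in>C. a \<ge> u"
    proof (cases "C = {}")
      case True
      then show ?thesis using p0 by auto
    next
      case False
      define u where "u = (\<lambda>x. INF p\<in>C. p x)"
      have low: "- p0 (- x) \<le> p x" if "p \<in> C" for p x
        using sublinear_neg[of p x] CA that le_funD[of p p0 "- x"] by force
      have le: "u x \<le> p x" if "p \<in> C" for p x
        unfolding u_def by (rule cINF_lower) (use that low in \<open>auto intro!: bdd_belowI2\<close>)
      have ge: "c \<le> u x" if "\<And>p. p \<in> C \<Longrightarrow> c \<le> p x" for c x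
        unfolding u_def by (rule cINF_greatest) (use that False in auto)
      have "sublinear u"
        unfolding sublinear_def
      proof (intro conjI allI impI)
        fix x y
        have *: "u (x + y) \<le> p x + r y" if "p \<in> C" "r \<in> C" for p r
        proof -
          have "p \<le> r \<or> r \<le> p" using C that by (auto simp: Chains_def relation_of_def)
          moreover have "p (x + y) \<le> p x + p y" "r (x + y) \<le> r x + r y"
            using CA that unfolding sublinear_def by blast+
          then have "u (x + y) \<le> p x + p y" "u (x + y) \<le> r x + r y"
            using le[OF that(1), of "x + y"] le[OF that(2), of "x + y"] by linarith+
          ultimately show ?thesis using le_funD[of p r y] le_funD[of r p x] by fastforce
        qed
        have "u (x + y) - p x \<le> u y" if "p \<in> C" for p
          by (rule ge) (use *[OF that] in \<open>simp add: algebra_simps\<close>)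
        then have "u (x + y) - u y \<le> u x" by (intro ge) (simp add: algebra_simps)
        then show "u (x + y) \<le> u x + u y" by simp
      next
        fix t :: real and x assume t: "t \<ge> 0"
        have sc: "p (t *\<^sub>R x) = t * p x" if "p \<in> C" for p
          using CA that t by (auto simp: sublinear_def)
        show "u (t *\<^sub>R x) = t * u x"
        proof (rule antisym)
          show "t * u x \<le> u (t *\<^sub>R x)"
            using le t by (intro ge) (simp add: sc mult_left_mono)
          show "u (t *\<^sub>R x) \<le> t * u x"
          proof (cases "t = 0")
            case True
            obtain p where p: "p \<in> C" using \<open>C \<noteq> {}\<close> by blast
            show ?thesis using True sc[OF p] le[OF p, of "t *\<^sub>R x"] by simp
          next
            case False
            then have "u (t *\<^sub>R x) / t \<le> u x"
              using le[of _ "t *\<^sub>R x"] sc t by (intro ge) (simp add: field_simps)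
            then show ?thesis using False t by (simp add: field_simps)
          qed
        qed
      qed
      moreover obtain p where p: "p \<in> C" using False by blast
      then have "u \<le> p0" using le[OF p] CA by (auto simp: le_fun_def intro: order_trans)
      ultimately show ?thesis using le by (auto simp: le_fun_def intro!: bexI[of _ u])
    qed
  qed
  then obtain m where m: "sublinear m" "m \<le> p0"
    and min: "\<And>r. sublinear r \<Longrightarrow> r \<le> p0 \<Longrightarrow> r \<le> m \<Longrightarrow> r = m" by blast
  show ?thesis
  proof (rule that[of m])
    show "sublinear m" "\<And>x. m x \<le> p0 x" using m by (auto simp: le_fun_def)
    show "r = m" if "sublinear r" "\<And>x. r x \<le> m x" for r
      using that m by (intro min) (auto simp: le_fun_def intro: order_trans)
  qed
qed

text \<open>The Hahn-Banach theorem for one vector. A minimal sublinear functional is unchanged by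
  \<open>shave\<close>, and the parameter \<open>t = 1\<close> then gives superadditivity, hence
  linearity. Starting below \<open>shave norm x0\<close> instead of \<open>norm\<close> forces the
  value \<open>norm x0\<close> at \<open>x0\<close>.\<close>

lemma norming_functional:
  fixes x0 :: "'a::real_normed_vector"
  obtains g :: "'a \<Rightarrow>\<^sub>L real" where "norm g \<le> 1" "blinfun_apply g x0 = norm x0"
proof -
  have n: "sublinear (norm :: 'a \<Rightarrow> real)"
    by (auto simp: sublinear_def norm_triangle_ineq)
  obtain m where m: "sublinear m" and le: "\<And>x. m x \<le> shave norm x0 x"
    and min: "\<And>r. sublinear r \<Longrightarrow> (\<And>x. r x \<le> m x) \<Longrightarrow> r = m"
    using minimal_sublinear_exists[OF sublinear_shave[OF n, of x0]] by metis
  have le_norm: "m x \<le> norm x" for x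
    using le[of x] shave_le[OF n, of 0 x0 x] by simp
  have sh: "shave m z = m" for z
  proof (rule min[OF sublinear_shave[OF m]])
    show "shave m z x \<le> m x" for x using shave_le[OF m, of 0 z x] by simp
  qed
  have add: "m (y + z) = m y + m z" for y z
  proof (rule antisym)
    show "m (y + z) \<le> m y + m z" using m by (simp add: sublinear_def)
    show "m y + m z \<le> m (y + z)" using shave_le[OF m, of 1 z y] sh[of z] by simp
  qed
  have neg: "m (- x) = - m x" for x
    using add[of x "- x"] sublinear_zero[OF m] by simp
  have scale: "m (t *\<^sub>R x) = t * m x" for t x
  proof (cases "t \<ge> 0")
    case True
    then show ?thesis using m by (simp add: sublinear_def)
  next
    case False
    then have "m ((- t) *\<^sub>R x) = (- t) * m x" using m by (simp add: sublinear_def del: scaleR_minus_left)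
    then show ?thesis using neg[of "t *\<^sub>R x"] by simp
  qed
  have abs: "\<bar>m x\<bar> \<le> norm x" for x
    using le_norm[of x] le_norm[of "- x"] neg[of x] by simp
  have bl: "bounded_linear m"
    by (rule bounded_linear_intro[of _ 1]) (use add scale abs in auto)
  have "m (- x0) \<le> - norm x0"
    using le[of "- x0"] shave_le[OF n, of 1 x0 "- x0"] by simp
  then have "m x0 = norm x0" using neg[of x0] le_norm[of x0] by simp
  then show ?thesis
    using bl abs by (intro that[of "Blinfun m"])
      (auto simp: bounded_linear_Blinfun_apply intro!: norm_blinfun_bound)
qed

section \<open>Closed subspaces of finite codimension\<close>

text \<open>Division by \<open>t\<close> turns the vector into \<open>v\<close> minus an element of
  \<open>E\<close>. When \<open>v\<close> has positive distance from \<open>E\<close>, this bounds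
  the \<open>v\<close>-coefficient.\<close>

lemma infdist_subspace_coeff:
  fixes E :: "'a::real_normed_vector set"
  assumes E: "subspace E" and e: "e \<in> E"
  shows "\<bar>t\<bar> * infdist v E \<le> norm (e + t *\<^sub>R v)"
proof (cases "t = 0")
  case False
  have "- (inverse t) *\<^sub>R e \<in> E" using E e by (rule subspace_mul)
  then have "infdist v E \<le> dist v (- (inverse t) *\<^sub>R e)" by (rule infdist_le)
  also have "\<dots> = norm (inverse t *\<^sub>R (e + t *\<^sub>R v))"
    using False by (simp add: dist_norm scaleR_add_right add.commute)
  also have "\<dots> = inverse \<bar>t\<bar> * norm (e + t *\<^sub>R v)" by simp
  finally show ?thesis using False by (simp add: field_simps)
qed simp

text \<open>Along a convergent sequence the coefficients of \<open>v\<close> are Cauchy by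
  \<open>infdist_subspace_coeff\<close>, so the limit splits in the same way.\<close>

lemma closed_span_insert:
  fixes E :: "'a::banach set"
  assumes E: "subspace E" "closed E"
  shows "closed (span (insert v E))"
proof (cases "v \<in> E")
  case True
  then show ?thesis using E by (simp add: insert_absorb span_eq_iff[THEN iffD2])
next
  case False
  have EE: "span E = E" using E by (simp add: span_eq_iff)
  define d where "d = infdist v E"
  have d: "d > 0"
    unfolding d_def using False E by (intro infdist_pos_not_in_closed) (auto dest: subspace_0)
  show ?thesis
    unfolding closed_sequential_limits
  proof (intro allI impI, elim conjE)
    fix y l assume y: "\<forall>n. y n \<in> span (insert v E)" and l: "y \<longlonglongrightarrow> l"
    have "\<forall>n. \<exists>k. y n - k *\<^sub>R v \<in> E" using y by (simp add: span_insert EE)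
    then obtain t where t: "\<And>n. y n - t n *\<^sub>R v \<in> E" by metis
    have dt: "d * \<bar>t m - t n\<bar> \<le> norm (y m - y n)" for m n
    proof -
      have "(y m - t m *\<^sub>R v) - (y n - t n *\<^sub>R v) \<in> E" by (rule subspace_diff[OF E(1) t t])
      from infdist_subspace_coeff[OF E(1) this, of "t m - t n" v] show ?thesis
        by (simp add: d_def algebra_simps)
    qed
    have "Cauchy t"
    proof (rule metric_CauchyI)
      fix e :: real assume "e > 0"
      then have "d * e > 0" using d by simp
      then obtain M where M: "\<And>m n. m \<ge> M \<Longrightarrow> n \<ge> M \<Longrightarrow> dist (y m) (y n) < d * e"
        using LIMSEQ_imp_Cauchy[OF l] unfolding Cauchy_def by blast
      have "dist (t m) (t n) < e" if "m \<ge> M" "n \<ge> M" for m n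
      proof -
        have "d * \<bar>t m - t n\<bar> < d * e" using dt[of m n] M[OF that] by (simp add: dist_norm)
        then show ?thesis using d by (simp add: dist_real_def)
      qed
      then show "\<exists>M. \<forall>m\<ge>M. \<forall>n\<ge>M. dist (t m) (t n) < e" by blast
    qed
    then obtain s where s: "t \<longlonglongrightarrow> s" using real_Cauchy_convergent convergent_def by blast
    have "(\<lambda>n. y n - t n *\<^sub>R v) \<longlonglongrightarrow> l - s *\<^sub>R v" by (intro tendsto_intros l s)
    with E(2) t have "l - s *\<^sub>R v \<in> E" by (rule closed_sequentially)
    then show "l \<in> span (insert v E)" by (auto simp: span_insert EE)
  qed
qed

lemma closed_span_finite:
  fixes S :: "'a::banach set"
  assumes "finite S"
  shows "closed (span S)"
  using assms
proof induction
  case (insert v S)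
  have "span (insert v S) = span (insert v (span S))"
    by (simp add: span_insert span_span)
  then show ?case using closed_span_insert[OF subspace_span insert.IH, of v] by simp
qed simp

text \<open>\<open>finite_codim\<close> admits subspaces that are not closed; they are replaced by
  their closures before \<open>finite_codim_projection\<close> is applied.\<close>

lemma subspace_closure:
  fixes E :: "'a::real_normed_vector set"
  assumes E: "subspace E"
  shows "subspace (closure E)"
proof (rule subspaceI)
  show "0 \<in> closure E" using subspace_0[OF E] closure_subset by blast
next
  fix x y assume "x \<in> closure E" "y \<in> closure E"
  then obtain X Y where "\<And>n. X n \<in> E" "X \<longlonglongrightarrow> x" "\<And>n. Y n \<in> E" "Y \<longlonglongrightarrow> y"
    by (metis closure_sequential)
  then show "x + y \<in> closure E"
    unfolding closure_sequential
    by (intro exI[of _ "\<lambda>n. X n + Y n"]) (auto intro: tendsto_add subspace_add[OF E])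
next
  fix c x assume "x \<in> closure E"
  then obtain X where "\<And>n. X n \<in> E" "X \<longlonglongrightarrow> x"
    by (metis closure_sequential)
  then show "c *\<^sub>R x \<in> closure E"
    unfolding closure_sequential
    by (intro exI[of _ "\<lambda>n. c *\<^sub>R X n"]) (auto intro: tendsto_scaleR subspace_mul[OF E])
qed

text \<open>A continuous finite-rank correction moves every vector into \<open>E\<close>. Along a
  weakly null family the correction tends to 0 in norm, which links weak convergence to asymptotic
  smoothness.\<close>

lemma finite_codim_projection:
  fixes E :: "'a::banach set"
  assumes "finite S" "subspace E" "closed E" "span (E \<union> S) = UNIV"
  shows "\<exists>G :: 'a \<Rightarrow> ('a \<Rightarrow>\<^sub>L real). \<forall>h. h - (\<Sum>v\<in>S. blinfun_apply (G v) h *\<^sub>R v) \<in> E"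
  using assms
proof (induction S arbitrary: E rule: finite_induct)
  case empty
  then show ?case by (simp add: span_eq_iff[THEN iffD2])
next
  case (insert v S)
  have EE: "span E = E" using insert.prems by (simp add: span_eq_iff)
  show ?case
  proof (cases "v \<in> E")
    case True
    then have "E \<union> insert v S = E \<union> S" by auto
    then obtain G where G: "\<And>h. h - (\<Sum>v\<in>S. blinfun_apply (G v) h *\<^sub>R v) \<in> E"
      using insert.IH[of E] insert.prems by auto
    have "(\<Sum>w\<in>S. blinfun_apply ((G(v := 0)) w) h *\<^sub>R w) = (\<Sum>w\<in>S. blinfun_apply (G w) h *\<^sub>R w)" for h
      using insert.hyps by (intro sum.cong) auto
    then show ?thesis using insert.hyps G by (intro exI[of _ "G(v := 0)"]) simp
  next
    case False
    define d where "d = infdist v E"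
    have d: "d > 0"
      unfolding d_def using False insert.prems
      by (intro infdist_pos_not_in_closed) (auto dest: subspace_0)
    \<comment> \<open>The induction hypothesis for \<open>E'\<close> leaves a remainder
      \<open>r h\<close> in \<open>E'\<close>. Its \<open>v\<close>-coefficient \<open>t h\<close>
      is unique modulo \<open>E\<close>, hence linear, and it is bounded because \<open>v\<close>
      has distance \<open>d > 0\<close> from \<open>E\<close>.\<close>
    define E' where "E' = span (insert v E)"
    have "span (E' \<union> S) = span (E \<union> insert v S)"
    proof
      have "insert v E \<union> S = E \<union> insert v S" by blast
      then show "span (E' \<union> S) \<subseteq> span (E \<union> insert v S)"
        unfolding E'_def by (intro span_minimal) (auto intro: span_base subsetD[OF span_mono])
      show "span (E \<union> insert v S) \<subseteq> span (E' \<union> S)"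
        unfolding E'_def by (intro span_mono) (auto intro: span_base)
    qed
    then obtain G where G: "\<And>h. h - (\<Sum>w\<in>S. blinfun_apply (G w) h *\<^sub>R w) \<in> E'"
      using insert.IH[of E'] insert.prems closed_span_insert[of E v] unfolding E'_def by auto
    define r where "r h = h - (\<Sum>w\<in>S. blinfun_apply (G w) h *\<^sub>R w)" for h
    have blr: "bounded_linear r"
      unfolding r_def by (intro bounded_linear_intros)
    have "\<forall>h. \<exists>k. r h - k *\<^sub>R v \<in> E" using G by (simp add: E'_def span_insert EE r_def)
    then obtain t where t: "\<And>h. r h - t h *\<^sub>R v \<in> E" by metis
    have uniq: "a = b" if "x - a *\<^sub>R v \<in> E" "x - b *\<^sub>R v \<in> E" for x a b
    proof -
      have "(x - a *\<^sub>R v) - (x - b *\<^sub>R v) \<in> E" by (rule subspace_diff[OF insert.prems(1) that])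
      from infdist_subspace_coeff[OF insert.prems(1) this, of "a - b" v]
      have "\<bar>a - b\<bar> * d \<le> 0" by (simp add: d_def algebra_simps)
      then show ?thesis using d by (simp add: mult_le_0_iff)
    qed
    obtain K where K: "\<And>x. norm (r x) \<le> norm x * K"
      using bounded_linear.bounded[OF blr] by blast
    have "bounded_linear t"
    proof (rule bounded_linear_intro[of _ "K / d"])
      fix x y
      have "(r x - t x *\<^sub>R v) + (r y - t y *\<^sub>R v) \<in> E"
        by (rule subspace_add[OF insert.prems(1) t t])
      then have "r (x + y) - (t x + t y) *\<^sub>R v \<in> E"
        by (simp add: bounded_linear.linear[OF blr] linear_add algebra_simps)
      then show "t (x + y) = t x + t y" using t uniq by blast
    next
      fix c x
      have "c *\<^sub>R (r x - t x *\<^sub>R v) \<in> E" by (rule subspace_mul[OF insert.prems(1) t])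
      then have "r (c *\<^sub>R x) - (c * t x) *\<^sub>R v \<in> E"
        by (simp add: bounded_linear.linear[OF blr] linear_cmul algebra_simps)
      then show "t (c *\<^sub>R x) = c *\<^sub>R t x" using t uniq by auto
    next
      fix x
      have "\<bar>t x\<bar> * d \<le> norm (r x)"
        using infdist_subspace_coeff[OF insert.prems(1) t[of x], of "t x" v] by (simp add: d_def)
      also have "\<dots> \<le> norm x * K" by (rule K)
      finally show "norm (t x) \<le> norm x * (K / d)" using d by (simp add: field_simps)
    qed
    then have ta: "blinfun_apply (Blinfun t) = t" by (simp add: bounded_linear_Blinfun_apply)
    have "h - (\<Sum>w\<in>insert v S. blinfun_apply ((G(v := Blinfun t)) w) h *\<^sub>R w) \<in> E" for h
    proof -
      have "(\<Sum>w\<in>S. blinfun_apply ((G(v := Blinfun t)) w) h *\<^sub>R w) = (\<Sum>w\<in>S. blinfun_apply (G w) h *\<^sub>R w)"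
        using insert.hyps by (intro sum.cong) auto
      then show ?thesis using insert.hyps t[of h] by (simp add: ta r_def algebra_simps)
    qed
    then show ?thesis by blast
  qed
qed

section \<open>Weak limits\<close>

definition weak_tendsto ::
    "('i \<Rightarrow> 'a::real_normed_vector) \<Rightarrow> 'a \<Rightarrow> 'i filter \<Rightarrow> bool" where
  "weak_tendsto h y U \<longleftrightarrow>
     (\<forall>g :: 'a \<Rightarrow>\<^sub>L real. ((\<lambda>n. blinfun_apply g (h n)) \<longlongrightarrow> blinfun_apply g y) U)"

lemma weak_tendsto_const: "weak_tendsto (\<lambda>n. y) y U"
  by (simp add: weak_tendsto_def)

lemma weak_tendsto_diff:
  "weak_tendsto h y U \<Longrightarrow> weak_tendsto h' y' U \<Longrightarrow> weak_tendsto (\<lambda>n. h n - h' n) (y - y') U"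
  by (auto simp: weak_tendsto_def blinfun.diff_right intro!: tendsto_diff)

text \<open>Weak lower semicontinuity of the norm, tested on a functional norming the limit.\<close>

lemma weak_tendsto_norm_le:
  assumes U: "U \<noteq> bot" and h: "weak_tendsto h y U" and b: "\<And>n. norm (h n) \<le> b"
  shows "norm y \<le> b"
proof -
  obtain g where g: "norm g \<le> 1" "blinfun_apply g y = norm y" by (rule norming_functional)
  have "((\<lambda>n. blinfun_apply g (h n)) \<longlongrightarrow> norm y) U"
    using h g(2) by (metis weak_tendsto_def)
  moreover have "blinfun_apply g (h n) \<le> b" for n
  proof -
    have "blinfun_apply g (h n) \<le> norm g * norm (h n)"
      using norm_blinfun[of g "h n"] by simp
    also have "\<dots> \<le> 1 * norm (h n)" using g(1) by (rule mult_right_mono) simp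
    finally show ?thesis using b[of n] by simp
  qed
  ultimately show ?thesis by (intro tendsto_upperbound[OF _ _ U]) auto
qed

text \<open>The limits of \<open>g (h n)\<close> along \<open>U\<close> depend linearly and
  boundedly on \<open>g\<close>. They form an element of the bidual, which reflexivity represents by
  a point.\<close>

lemma reflexive_weak_limit_exists:
  fixes h :: "'i \<Rightarrow> 'a::real_normed_vector"
  assumes R: "reflexive_space TYPE('a)" and U: "ultrafilter U" and b: "\<And>n. norm (h n) \<le> b"
  shows "\<exists>y. weak_tendsto h y U"
proof -
  note nb = ultrafilter_not_bot[OF U]
  have gb: "\<bar>blinfun_apply g (h n)\<bar> \<le> norm g * b" for g :: "'a \<Rightarrow>\<^sub>L real" and n
    using norm_blinfun[of g "h n"] mult_left_mono[OF b[of n], of "norm g"] by simp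
  have "\<exists>l. ((\<lambda>n. blinfun_apply g (h n)) \<longlongrightarrow> l) U" for g :: "'a \<Rightarrow>\<^sub>L real"
    by (rule ultrafilter_tendsto_bounded[OF U, of "\<lambda>n. blinfun_apply g (h n)"]) (use gb[of g] in auto)
  then obtain L :: "('a \<Rightarrow>\<^sub>L real) \<Rightarrow> real"
    where L: "\<And>g. ((\<lambda>n. blinfun_apply g (h n)) \<longlongrightarrow> L g) U" by metis
  have "bounded_linear L"
  proof (rule bounded_linear_intro[of _ b])
    fix f g
    have "((\<lambda>n. blinfun_apply (f + g) (h n)) \<longlongrightarrow> L f + L g) U"
      by (simp add: blinfun.add_left tendsto_add L)
    then show "L (f + g) = L f + L g" using tendsto_unique[OF nb L] by blast
  next
    fix c f
    have "((\<lambda>n. blinfun_apply (c *\<^sub>R f) (h n)) \<longlongrightarrow> c * L f) U"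
      by (simp add: blinfun.scaleR_left tendsto_mult_left L)
    then show "L (c *\<^sub>R f) = c *\<^sub>R L f" using tendsto_unique[OF nb L] by simp
  next
    fix f
    show "norm (L f) \<le> norm f * b"
      using tendsto_upperbound[OF tendsto_rabs[OF L[of f]] _ nb, of "norm f * b"] gb by simp
  qed
  then have "blinfun_apply (Blinfun L) = L" by (simp add: bounded_linear_Blinfun_apply)
  then obtain y where "\<And>g. L g = blinfun_apply g y"
    using R unfolding reflexive_space_def by metis
  then show ?thesis using L by (auto simp: weak_tendsto_def)
qed

section \<open>Adding weakly null increments\<close>

text \<open>The assumed bound concerns only the unit vector \<open>x\<close> and steps of length
  exactly \<open>lam / B\<close>. Convexity extends it to all multiples up to \<open>B\<close> and
  steps up to \<open>lam\<close>; the excess of \<open>norm e\<close> over \<open>lam\<close> is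
  paid for by the triangle inequality.\<close>

lemma norm_add_le_of_unit_bound:
  fixes x :: "'a::real_normed_vector"
  assumes E: "subspace E" and x: "norm x = 1" and B: "0 < lam" "lam \<le> B" and D: "D \<ge> 0"
    and bd: "\<And>u. u \<in> E \<Longrightarrow> norm u = 1 \<Longrightarrow> norm (x + (lam / B) *\<^sub>R u) \<le> 1 + D"
    and e: "e \<in> E" and \<theta>: "0 \<le> \<theta>" "\<theta> \<le> B"
  shows "norm (\<theta> *\<^sub>R x + e) \<le> B * (1 + D) + max 0 (norm e - lam)"
proof -
  have BD: "B \<le> B * (1 + D)" using B D by (simp add: algebra_simps)
  have unit: "norm (\<theta> *\<^sub>R x + s *\<^sub>R u) \<le> B * (1 + D)"
    if u: "u \<in> E" "norm u = 1" and s: "0 \<le> s" "s \<le> lam" for u s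
  proof -
    \<comment> \<open>\<open>\<theta>x + su\<close> lies in the convex hull of \<open>0\<close>, \<open>Bx\<close>, \<open>lam u\<close> and \<open>Bx + lam u\<close>.\<close>
    have "\<theta> *\<^sub>R x + s *\<^sub>R u
        = (\<theta> / B) *\<^sub>R ((s / lam) *\<^sub>R (B *\<^sub>R (x + (lam / B) *\<^sub>R u)) + (1 - s / lam) *\<^sub>R (B *\<^sub>R x))
          + (1 - \<theta> / B) *\<^sub>R (s *\<^sub>R u)"
      using B by (simp add: algebra_simps)
    also have "norm \<dots> \<le> (\<theta> / B) * ((s / lam) * (B * (1 + D)) + (1 - s / lam) * (B * (1 + D)))
          + (1 - \<theta> / B) * (B * (1 + D))"
    proof -
      have 1: "norm (B *\<^sub>R (x + (lam / B) *\<^sub>R u)) \<le> B * (1 + D)"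
        using bd[OF u] B by simp
      have 2: "norm (B *\<^sub>R x) \<le> B * (1 + D)" using x B D by simp
      have 3: "norm (s *\<^sub>R u) \<le> B * (1 + D)" using u s order_trans[OF order_trans[OF s(2) B(2)] BD] by simp
      have "0 \<le> s / lam" "0 \<le> 1 - s / lam" "0 \<le> \<theta> / B" "0 \<le> 1 - \<theta> / B"
        using s B \<theta> by (auto simp: field_simps)
      note nn = this
      have sc: "norm (c *\<^sub>R w) \<le> c * b" if "0 \<le> c" "norm w \<le> b" for c b :: real and w :: 'a
        using that by (simp add: mult_left_mono)
      show ?thesis
        by (intro norm_triangle_mono sc 1 2 3 nn)
    qed
    also have "\<dots> = B * (1 + D)" by (simp add: algebra_simps)
    finally show ?thesis .
  qed
  show ?thesis
  proof (cases "e = 0")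
    case True
    show ?thesis using True x \<theta> order_trans[OF \<theta>(2) BD] by simp
  next
    case False
    define u where "u = (1 / norm e) *\<^sub>R e"
    have u: "u \<in> E" "norm u = 1" "e = norm e *\<^sub>R u"
      using False E e by (auto simp: u_def subspace_mul)
    define s where "s = min (norm e) lam"
    have "\<theta> *\<^sub>R x + e = (\<theta> *\<^sub>R x + s *\<^sub>R u) + (norm e - s) *\<^sub>R u"
      using u(3) by (simp add: algebra_simps)
    also have "norm \<dots> \<le> B * (1 + D) + max 0 (norm e - lam)"
      using u B by (intro norm_triangle_mono unit) (auto simp: s_def)
    finally show ?thesis .
  qed
qed

definition smooth_with :: "real \<Rightarrow> real \<Rightarrow> 'b::real_normed_vector itself \<Rightarrow> bool" where
  "smooth_with q C T \<longleftrightarrow> C \<ge> 0 \<and> (\<forall>t\<in>{0..1}. asymp_smooth_modulus T t \<le> ereal (C * t powr q))"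

lemma smooth_with_exists:
  assumes "asymp_q_uniformly_smooth q T"
  obtains C where "smooth_with q C T"
proof -
  obtain C where C: "\<And>t. t \<in> {0..1} \<Longrightarrow> asymp_smooth_modulus T t \<le> ereal (C * t powr q)"
    using assms unfolding asymp_q_uniformly_smooth_def by blast
  have "smooth_with q (max 0 C) T"
    unfolding smooth_with_def
  proof (intro conjI ballI)
    fix t :: real assume t: "t \<in> {0..1}"
    have "C * t powr q \<le> max 0 C * t powr q" by (rule mult_right_mono) auto
    then show "asymp_smooth_modulus T t \<le> ereal (max 0 C * t powr q)"
      using C[OF t] by (meson ereal_less_eq(3) order_trans)
  qed simp
  then show ?thesis using that by blast
qed

text \<open>The infimum over subspaces in the modulus may not be attained, which costs
  \<open>\<epsilon>\<close>.\<close>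

lemma smooth_with_subspace:
  fixes x :: "'b::real_normed_vector"
  assumes S: "smooth_with q C TYPE('b)" and x: "norm x = 1" and t: "t \<in> {0..1}" and e: "\<epsilon> > 0"
  obtains E where "finite_codim E"
    "\<And>u. u \<in> E \<Longrightarrow> norm u = 1 \<Longrightarrow> norm (x + t *\<^sub>R u) \<le> 1 + (C * t powr q + \<epsilon>)"
proof -
  have "(INF E\<in>{E::'b set. finite_codim E}. SUP h\<in>E \<inter> sphere 0 1. ereal (norm (x + t *\<^sub>R h) - 1))
      \<le> asymp_smooth_modulus TYPE('b) t"
    unfolding asymp_smooth_modulus_def using x by (intro SUP_upper) simp
  also have "\<dots> \<le> ereal (C * t powr q)" using S t by (simp add: smooth_with_def)
  also have "\<dots> < ereal (C * t powr q + \<epsilon>)" using e by simp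
  finally obtain E where E: "finite_codim E"
    "(SUP h\<in>E \<inter> sphere 0 1. ereal (norm (x + t *\<^sub>R h) - 1)) < ereal (C * t powr q + \<epsilon>)"
    by (auto simp: INF_less_iff)
  have "norm (x + t *\<^sub>R u) \<le> 1 + (C * t powr q + \<epsilon>)" if "u \<in> E" "norm u = 1" for u
  proof -
    have "ereal (norm (x + t *\<^sub>R u) - 1) \<le> (SUP h\<in>E \<inter> sphere 0 1. ereal (norm (x + t *\<^sub>R h) - 1))"
      using that by (intro SUP_upper) simp
    then have "ereal (norm (x + t *\<^sub>R u) - 1) < ereal (C * t powr q + \<epsilon>)"
      using E(2) by (rule le_less_trans)
    then show ?thesis by simp
  qed
  then show ?thesis using that E(1) by blast
qed

text \<open>Up to an error tending to 0 in norm, the increments \<open>h n\<close> lie in the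
  closure of a subspace \<open>E\<close> adapted to the direction of \<open>x\<close>, where the
  smoothness estimate applies with \<open>t = lam / B\<close>.\<close>

lemma smooth_step:
  fixes x :: "'b::banach"
  assumes S: "smooth_with q C TYPE('b)" and x: "norm x \<le> B" and B: "0 < lam" "lam \<le> B"
    and e: "\<epsilon> > 0" and h: "weak_tendsto h 0 U" and hb: "\<And>n. norm (h n) \<le> lam"
  shows "eventually (\<lambda>n. norm (x + h n) \<le> B * (1 + (C * (lam / B) powr q + \<epsilon>))) U"
proof (cases "x = 0")
  case True
  have C0: "C * (lam / B) powr q \<ge> 0" using S by (simp add: smooth_with_def)
  have "norm (h n) \<le> B * (1 + (C * (lam / B) powr q + \<epsilon>))" for n
  proof -
    have "norm (h n) \<le> B * 1" using hb[of n] B by simp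
    also have "\<dots> \<le> B * (1 + (C * (lam / B) powr q + \<epsilon>))"
      using B e C0 by (intro mult_left_mono) auto
    finally show ?thesis .
  qed
  then show ?thesis using True by simp
next
  case False
  define x' where "x' = (1 / norm x) *\<^sub>R x"
  have x': "norm x' = 1" "x = norm x *\<^sub>R x'" using False by (auto simp: x'_def)
  \<comment> \<open>Half of \<open>\<epsilon>\<close> is spent on choosing \<open>E\<close>. The
    other half pays twice for the error \<open>r n\<close>: once for displacing the vector, once for
    the excess of \<open>norm (h n - r n)\<close> over \<open>lam\<close>.\<close>
  define D where "D = C * (lam / B) powr q + \<epsilon> / 2"
  have D0: "D \<ge> 0" unfolding D_def using S e by (simp add: smooth_with_def)
  have "lam / B \<in> {0..1}" "\<epsilon> / 2 > 0" using B e by auto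
  from smooth_with_subspace[OF S x'(1) this] obtain E where E: "finite_codim E"
    "\<And>u. u \<in> E \<Longrightarrow> norm u = 1 \<Longrightarrow> norm (x' + (lam / B) *\<^sub>R u) \<le> 1 + D"
    unfolding D_def by metis
  obtain T where T: "finite T" "span (E \<union> T) = UNIV" and sE: "subspace E"
    using E(1) by (auto simp: finite_codim_def)
  let ?R = "\<lambda>w. norm (x + w) \<le> B * (1 + D) + max 0 (norm w - lam)"
  \<comment> \<open>The estimate is a closed condition on \<open>w\<close>, so it passes from
    \<open>E\<close> to its closure.\<close>
  have "closed {w. ?R w}" by (intro closed_Collect_le continuous_intros)
  moreover have "E \<subseteq> {w. ?R w}"
    using norm_add_le_of_unit_bound[OF sE x'(1) B D0 E(2) _ norm_ge_zero x] x'(2) by auto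
  ultimately have cl: "closure E \<subseteq> {w. ?R w}" by (rule closure_minimal[rotated])
  have "span (closure E \<union> T) = UNIV"
    using T(2) span_mono[of "E \<union> T" "closure E \<union> T"] closure_subset[of E] by blast
  then obtain G :: "'b \<Rightarrow> ('b \<Rightarrow>\<^sub>L real)"
    where G: "\<And>w. w - (\<Sum>v\<in>T. blinfun_apply (G v) w *\<^sub>R v) \<in> closure E"
    using finite_codim_projection[OF T(1) subspace_closure[OF sE] closed_closure] by blast
  define r where "r n = (\<Sum>v\<in>T. blinfun_apply (G v) (h n) *\<^sub>R v)" for n
  have "((\<lambda>n. blinfun_apply (G v) (h n)) \<longlongrightarrow> 0) U" for v
    using h by (auto simp: weak_tendsto_def dest: spec[of _ "G v"])
  then have "(r \<longlongrightarrow> (\<Sum>v\<in>T. 0 *\<^sub>R v)) U"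
    unfolding r_def by (intro tendsto_intros)
  then have "(r \<longlongrightarrow> 0) U" by simp
  then have "eventually (\<lambda>n. norm (r n) < B * \<epsilon> / 4) U"
    using tendstoD[of r 0 U "B * \<epsilon> / 4"] B e by simp
  then show ?thesis
  proof eventually_elim
    case (elim n)
    have "norm (x + (h n - r n)) \<le> B * (1 + D) + max 0 (norm (h n - r n) - lam)"
      using cl G[of "h n"] by (auto simp: r_def)
    also have "max 0 (norm (h n - r n) - lam) \<le> norm (r n)"
      using hb[of n] norm_triangle_ineq4[of "h n" "r n"] by simp
    finally have "norm (x + (h n - r n)) \<le> B * (1 + D) + norm (r n)" by simp
    moreover have "norm (x + h n) \<le> norm (x + (h n - r n)) + norm (r n)"
      using norm_triangle_ineq[of "x + (h n - r n)" "r n"] by simp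
    ultimately have "norm (x + h n) \<le> B * (1 + D) + B * \<epsilon> / 2" using elim by linarith
    then show ?case unfolding D_def by (simp add: algebra_simps)
  qed
qed

section \<open>Concentration for maps on tuples\<close>

text \<open>Dependent choice where each term may depend on the finite set of its predecessors. It
  serves both \<open>admissible_tuple_selection\<close> and the separated sequence in
  \<open>compression_co_banach_saks\<close>.\<close>

lemma finite_prefix_choice:
  assumes "\<And>n S. finite S \<Longrightarrow> \<exists>v. P n S v"
  obtains x :: "nat \<Rightarrow> 'a" where "\<And>n. P n (x ` {..<n}) (x n)"
proof -
  define pick where "pick n S = (SOME v. P n S v)" for n S
  have pick: "P n S (pick n S)" if "finite S" for n S
    unfolding pick_def by (rule someI_ex[OF assms[OF that]])
  define A where "A = rec_nat {} (\<lambda>n S. insert (pick n S) S)"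
  have A0: "A 0 = {}" and AS: "A (Suc n) = insert (pick n (A n)) (A n)" for n
    by (simp_all add: A_def)
  have fin: "finite (A n)" for n by (induction n) (auto simp: A0 AS)
  have A_eq: "(\<lambda>i. pick i (A i)) ` {..<n} = A n" for n
    by (induction n) (auto simp: A0 AS lessThan_Suc)
  have "P n ((\<lambda>i. pick i (A i)) ` {..<n}) (pick n (A n))" for n
    unfolding A_eq by (rule pick[OF fin])
  then show ?thesis by (rule that)
qed

text \<open>The index condition of \<open>co_banach_saks\<close>. The bound
  \<open>k \<le> J i\<close> is what lets a single infinite index set serve all lengths
  \<open>k\<close>.\<close>

definition admissible :: "nat \<Rightarrow> (nat \<Rightarrow> nat) \<Rightarrow> bool" where
  "admissible k J \<longleftrightarrow> (\<forall>i<k. k \<le> J i) \<and> (\<forall>i. Suc i < k \<longrightarrow> J i < J (Suc i))"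

lemma admissible_mono:
  assumes "admissible k J" "i < j" "j < k"
  shows "J i < J j"
  using assms(2,3)
proof (induction j)
  case (Suc j)
  have "J j < J (Suc j)" using assms(1) Suc.prems by (simp add: admissible_def)
  then show ?case using Suc by (cases "i = j") auto
qed simp

text \<open>The index \<open>M r\<close> is chosen to extend every good tuple of earlier indices for
  all \<open>k \<le> r\<close>: finitely many requirements, each satisfied along \<open>U\<close>.
  They suffice since an admissible \<open>k\<close>-tuple uses only positions from \<open>k\<close>
  on.\<close>

lemma admissible_tuple_selection:
  assumes nb: "U \<noteq> bot" and U: "U \<le> sequentially"
    and P0: "\<And>k. P k []"
    and step: "\<And>k ns. length ns < k \<Longrightarrow> P k ns \<Longrightarrow> eventually (\<lambda>n. P k (ns @ [n])) U"
  obtains M :: "nat \<Rightarrow> nat" where "strict_mono M"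
    "\<And>k J. admissible k J \<Longrightarrow> P k (map (\<lambda>i. M (J i)) [0..<k])"
proof -
  define Q where "Q r A n \<longleftrightarrow> (\<forall>a\<in>A. a < n) \<and>
    (\<forall>k\<le>r. \<forall>ns. set ns \<subseteq> A \<and> length ns < k \<and> P k ns \<longrightarrow> P k (ns @ [n]))" for r A n
  have "\<exists>n. Q r A n" if A: "finite A" for r A
  proof -
    define T where "T = {(k, ns). k \<le> r \<and> set ns \<subseteq> A \<and> length ns < k \<and> P k ns}"
    have "T \<subseteq> {..r} \<times> {ns. set ns \<subseteq> A \<and> length ns \<le> r}" by (auto simp: T_def)
    then have "finite T" using finite_lists_length_le[OF A] finite_subset by blast
    then have "eventually (\<lambda>n. \<forall>(k, ns)\<in>T. P k (ns @ [n])) U"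
      using step by (intro eventually_ball_finite) (auto simp: T_def)
    moreover have "eventually (\<lambda>n. \<forall>a\<in>A. a < n) U"
      using A U by (intro eventually_ball_finite) (auto intro: filter_leD eventually_gt_at_top)
    ultimately have "eventually (\<lambda>n. Q r A n) U"
      by eventually_elim (auto simp: Q_def T_def)
    then show ?thesis using nb eventually_happens' by blast
  qed
  then obtain M where M: "\<And>r. Q r (M ` {..<r}) (M r)" by (rule finite_prefix_choice[of Q]) blast+
  have "strict_mono M"
    using M by (intro strict_monoI) (auto simp: Q_def)
  moreover have "P k (map (\<lambda>i. M (J i)) [0..<k])" if J: "admissible k J" for k J
  proof -
    have "P k (map (\<lambda>i. M (J i)) [0..<j])" if "j \<le> k" for j
      using that
    proof (induction j)
      case 0
      then show ?case by (simp add: P0)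
    next
      case (Suc j)
      let ?ns = "map (\<lambda>i. M (J i)) [0..<j]"
      have "P k ?ns" "length ?ns < k" using Suc by auto
      moreover have "k \<le> J j" using J Suc.prems by (simp add: admissible_def)
      moreover have "set ?ns \<subseteq> M ` {..<J j}" using admissible_mono[OF J] Suc.prems by auto
      ultimately have "P k (?ns @ [M (J j)])" using M[of "J j"] unfolding Q_def by blast
      then show ?case by simp
    qed
    then show ?thesis by simp
  qed
  ultimately show ?thesis using that by blast
qed

text \<open>The Lipschitz condition for the Hamming metric on \<open>k\<close>-tuples. Entries may
  repeat and come in any order, so limits in single coordinates need no side conditions.\<close>

definition coord_lipschitz :: "real \<Rightarrow> nat \<Rightarrow> (nat list \<Rightarrow> 'b::real_normed_vector) \<Rightarrow> bool" where
  "coord_lipschitz lam k f \<longleftrightarrow>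
     (\<forall>as m n bs. length as + Suc (length bs) = k \<longrightarrow> norm (f (as @ m # bs) - f (as @ n # bs)) \<le> lam)"

text \<open>The last \<open>i\<close> coordinates are eliminated by weak limits, the very last one
  first. \<open>SOME\<close> is meaningful only when the limit exists, which
  \<open>coord_lipschitz_weak_limit\<close> secures.\<close>

fun iterated_limit ::
    "nat filter \<Rightarrow> (nat list \<Rightarrow> 'b::real_normed_vector) \<Rightarrow> nat \<Rightarrow> nat list \<Rightarrow> 'b" where
  "iterated_limit U f 0 ns = f ns"
| "iterated_limit U f (Suc i) ns = (SOME y. weak_tendsto (\<lambda>n. iterated_limit U f i (ns @ [n])) y U)"

lemma coord_lipschitz_weak_limit:
  fixes f :: "nat list \<Rightarrow> 'b::real_normed_vector"
  assumes R: "reflexive_space TYPE('b)" and U: "ultrafilter U"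
    and L: "coord_lipschitz lam (Suc (length ns)) (iterated_limit U f i)"
  shows "weak_tendsto (\<lambda>n. iterated_limit U f i (ns @ [n])) (iterated_limit U f (Suc i) ns) U"
proof -
  have "norm (iterated_limit U f i (ns @ [n])) \<le> norm (iterated_limit U f i (ns @ [0])) + lam" for n
  proof -
    have "norm (iterated_limit U f i (ns @ [n]) - iterated_limit U f i (ns @ [0])) \<le> lam"
      using L unfolding coord_lipschitz_def by simp
    then show ?thesis using norm_triangle_sub[of "iterated_limit U f i (ns @ [n])"] by (meson add_left_mono order_trans)
  qed
  from someI_ex[OF reflexive_weak_limit_exists[OF R U this]] show ?thesis by simp
qed

text \<open>Weak lower semicontinuity of the norm preserves the constant \<open>lam\<close> in each
  limit.\<close>

lemma coord_lipschitz_iterated_limit: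
  fixes f :: "nat list \<Rightarrow> 'b::real_normed_vector"
  assumes R: "reflexive_space TYPE('b)" and U: "ultrafilter U"
    and L: "coord_lipschitz lam k f" and "i \<le> k"
  shows "coord_lipschitz lam (k - i) (iterated_limit U f i)"
  using \<open>i \<le> k\<close>
proof (induction i)
  case 0
  have "iterated_limit U f 0 = f" by auto
  then show ?case using L by simp
next
  case (Suc i)
  then have IH: "coord_lipschitz lam (k - i) (iterated_limit U f i)" by simp
  show ?case
    unfolding coord_lipschitz_def
  proof (intro allI impI)
    fix as bs :: "nat list" and m n :: nat
    assume l: "length as + Suc (length bs) = k - Suc i"
    have len: "Suc (length (as @ c # bs)) = k - i" for c using l Suc.prems by simp
    have w: "weak_tendsto (\<lambda>x. iterated_limit U f i ((as @ c # bs) @ [x]))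
        (iterated_limit U f (Suc i) (as @ c # bs)) U" for c
      by (rule coord_lipschitz_weak_limit[OF R U]) (use IH len[of c] in simp)
    show "norm (iterated_limit U f (Suc i) (as @ m # bs) - iterated_limit U f (Suc i) (as @ n # bs)) \<le> lam"
    proof (rule weak_tendsto_norm_le[OF ultrafilter_not_bot[OF U] weak_tendsto_diff[OF w w]])
      fix x
      have "length as + Suc (length (bs @ [x])) = k - i" using len[of 0] by simp
      then show "norm (iterated_limit U f i ((as @ m # bs) @ [x])
          - iterated_limit U f i ((as @ n # bs) @ [x])) \<le> lam"
        using IH unfolding coord_lipschitz_def by (metis append.assoc append_Cons)
    qed
  qed
qed

text \<open>The allowed distance starts at \<open>lam * real k powr (1 / q)\<close>, although the
  true distance is 0 at \<open>[]\<close>, and gains one factor per coordinate. In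
  \<open>C + 1\<close>, the \<open>C\<close> comes from smoothness and the 1 from the choice
  \<open>1 / real k\<close> for the error in \<open>smooth_step\<close>.\<close>

definition limit_close ::
    "nat filter \<Rightarrow> real \<Rightarrow> real \<Rightarrow> real \<Rightarrow> nat \<Rightarrow> (nat list \<Rightarrow> 'b::real_normed_vector) \<Rightarrow> nat list \<Rightarrow> bool" where
  "limit_close U q C lam k f ns \<longleftrightarrow>
     norm (iterated_limit U f (k - length ns) ns - iterated_limit U f k [])
       \<le> lam * real k powr (1 / q) * (1 + (C + 1) / real k) ^ length ns"

text \<open>One application of \<open>smooth_step\<close> to the next increment \<open>h\<close>.
  The allowed distance \<open>B\<close> is at least \<open>lam * real k powr (1 / q)\<close>, so
  \<open>(lam / B) powr q\<close> is at most \<open>1 / real k\<close>.\<close>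

lemma limit_close_extend:
  fixes f :: "nat list \<Rightarrow> 'b::banach"
  assumes R: "reflexive_space TYPE('b)" and S: "smooth_with q C TYPE('b)" and q: "q > 0"
    and U: "ultrafilter U" and lam: "lam > 0" and L: "coord_lipschitz lam k f"
    and len: "length ns < k" and close: "limit_close U q C lam k f ns"
  shows "eventually (\<lambda>n. limit_close U q C lam k f (ns @ [n])) U"
proof -
  define i where "i = k - Suc (length ns)"
  have i: "k - length ns = Suc i" "Suc i \<le> k" "k - i = Suc (length ns)" using len by (auto simp: i_def)
  define B where "B = lam * real k powr (1 / q) * (1 + (C + 1) / real k) ^ length ns"
  define x where "x = iterated_limit U f (Suc i) ns - iterated_limit U f k []"
  define h where "h n = iterated_limit U f i (ns @ [n]) - iterated_limit U f (Suc i) ns" for n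
  have C: "C \<ge> 0" using S by (simp add: smooth_with_def)
  have k: "real k \<ge> 1" using len by simp
  have kp: "real k powr (1 / q) \<ge> 1" using k q by (simp add: ge_one_powr_ge_zero)
  have "(1 + (C + 1) / real k) ^ length ns \<ge> 1" using C k by (intro one_le_power) simp
  then have B1: "B \<ge> lam * real k powr (1 / q)"
    using lam kp mult_left_mono[of 1 "(1 + (C + 1) / real k) ^ length ns" "lam * real k powr (1 / q)"]
    unfolding B_def by simp
  then have B2: "lam \<le> B" using lam mult_left_mono[OF kp, of lam] by linarith
  have Li: "coord_lipschitz lam (Suc (length ns)) (iterated_limit U f i)"
    using coord_lipschitz_iterated_limit[OF R U L, of i] i by simp
  have w: "weak_tendsto (\<lambda>n. iterated_limit U f i (ns @ [n])) (iterated_limit U f (Suc i) ns) U"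
    by (rule coord_lipschitz_weak_limit[OF R U Li])
  have w0: "weak_tendsto h 0 U"
    using weak_tendsto_diff[OF w weak_tendsto_const, of "iterated_limit U f (Suc i) ns"]
    by (simp add: h_def[abs_def])
  \<comment> \<open>For fixed \<open>n\<close>, \<open>h n\<close> is the weak limit over
    \<open>m\<close> of differences that change only the last coordinate.\<close>
  have hb: "norm (h n) \<le> lam" for n
    unfolding h_def
  proof (rule weak_tendsto_norm_le[OF ultrafilter_not_bot[OF U] weak_tendsto_diff[OF weak_tendsto_const w]])
    show "norm (iterated_limit U f i (ns @ [n]) - iterated_limit U f i (ns @ [m])) \<le> lam" for m
      using Li unfolding coord_lipschitz_def by simp
  qed
  have xB: "norm x \<le> B" using close i(1) by (simp add: limit_close_def x_def B_def)
  have "C * (lam / B) powr q \<le> C * (1 / real k)"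
  proof (rule mult_left_mono[OF _ C])
    have "lam / B \<le> lam / (lam * real k powr (1 / q))"
      using B1 B2 lam k by (intro divide_left_mono mult_pos_pos) auto
    also have "\<dots> = (1 / real k) powr (1 / q)" using lam k by (simp add: powr_divide)
    finally have "(lam / B) powr q \<le> ((1 / real k) powr (1 / q)) powr q"
      using lam B2 q by (intro powr_mono2) auto
    also have "\<dots> = 1 / real k" using q k by (simp add: powr_powr)
    finally show "(lam / B) powr q \<le> 1 / real k" .
  qed
  then have le: "B * (1 + (C * (lam / B) powr q + 1 / real k)) \<le> B * (1 + (C + 1) / real k)"
    using lam B2 by (intro mult_left_mono) (auto simp: add_divide_distrib)
  have e: "1 / real k > 0" using k by simp
  from smooth_step[OF S xB lam B2 e w0 hb] show ?thesis
  proof eventually_elim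
    case (elim n)
    have "x + h n = iterated_limit U f (k - length (ns @ [n])) (ns @ [n]) - iterated_limit U f k []"
      by (simp add: x_def h_def i_def)
    with elim le show ?case
      unfolding limit_close_def by (simp add: B_def mult.assoc mult.commute mult.left_commute)
  qed
qed

text \<open>After all \<open>k\<close> coordinates the growth factors multiply to at most
  \<open>exp (C + 1)\<close>, uniformly in \<open>k\<close>. The constant \<open>K\<close> is fixed
  before \<open>lam\<close> and \<open>F\<close>, and one \<open>M\<close> serves every
  \<open>k\<close>.\<close>

lemma tuple_concentration:
  assumes R: "reflexive_space TYPE('b::banach)" and S: "asymp_q_uniformly_smooth q TYPE('b)" and q: "q > 0"
  obtains K where "K > 0"
    "\<And>lam F. lam > 0 \<Longrightarrow> (\<And>k. coord_lipschitz lam k (F k :: nat list \<Rightarrow> 'b)) \<Longrightarrow>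
       \<exists>M y. strict_mono M \<and> (\<forall>k>0. \<forall>J. admissible k J \<longrightarrow>
         norm (F k (map (\<lambda>i. M (J i)) [0..<k]) - y k) \<le> K * lam * real k powr (1 / q))"
proof -
  obtain C where C: "smooth_with q C TYPE('b)" using S smooth_with_exists by blast
  obtain U :: "nat filter" where U: "ultrafilter U" "U \<le> sequentially"
    using ultrafilter_exists sequentially_bot by blast
  show ?thesis
  proof (rule that[of "exp (C + 1)"])
    fix lam and F :: "nat \<Rightarrow> nat list \<Rightarrow> 'b"
    assume lam: "lam > 0" and L: "\<And>k. coord_lipschitz lam k (F k)"
    have "limit_close U q C lam k (F k) []" for k using lam by (simp add: limit_close_def)
    moreover have "eventually (\<lambda>n. limit_close U q C lam k (F k) (ns @ [n])) U"
      if "length ns < k" "limit_close U q C lam k (F k) ns" for k ns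
      by (rule limit_close_extend[OF R C q U(1) lam L that])
    ultimately obtain M where M: "strict_mono M"
      "\<And>k J. admissible k J \<Longrightarrow> limit_close U q C lam k (F k) (map (\<lambda>i. M (J i)) [0..<k])"
      by (rule admissible_tuple_selection[OF ultrafilter_not_bot[OF U(1)] U(2),
            of "\<lambda>k. limit_close U q C lam k (F k)"]) blast+
    have "norm (F k (map (\<lambda>i. M (J i)) [0..<k]) - iterated_limit U (F k) k [])
        \<le> exp (C + 1) * lam * real k powr (1 / q)" if k: "k > 0" and J: "admissible k J" for k J
    proof -
      have "C \<ge> 0" using C by (simp add: smooth_with_def)
      then have "(1 + (C + 1) / real k) ^ k \<le> exp (C + 1)"
        using exp_ge_one_plus_x_over_n_power_n[of k "C + 1"] k by simp
      then have "lam * real k powr (1 / q) * (1 + (C + 1) / real k) ^ k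
          \<le> lam * real k powr (1 / q) * exp (C + 1)"
        using lam by (intro mult_left_mono) auto
      with M(2)[OF J] show ?thesis by (simp add: limit_close_def mult_ac)
    qed
    then show "\<exists>M y. strict_mono M \<and> (\<forall>k>0. \<forall>J. admissible k J \<longrightarrow>
         norm (F k (map (\<lambda>i. M (J i)) [0..<k]) - y k) \<le> exp (C + 1) * lam * real k powr (1 / q))"
      using M(1) by (intro exI[of _ M] exI[of _ "\<lambda>k. iterated_limit U (F k) k []"]) auto
  qed simp
qed

text \<open>Changing one index moves the sum by at most \<open>2 * b\<close>, so
  \<open>omega_f f (2 * b)\<close> bounds the coordinatewise oscillation of \<open>F k\<close>.
  Comparing two tuples through \<open>y k\<close> doubles the constant.\<close>

lemma coarse_concentration:
  fixes f :: "'a::real_normed_vector \<Rightarrow> 'b::banach" and x :: "nat \<Rightarrow> 'a"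
  assumes R: "reflexive_space TYPE('b)" and S: "asymp_q_uniformly_smooth q TYPE('b)" and q: "q > 0"
    and f: "coarse_embedding f" and x: "\<And>n. norm (x n) \<le> b"
  obtains M A where "strict_mono M" "A > 0"
    "\<And>k J J'. k > 0 \<Longrightarrow> admissible k J \<Longrightarrow> admissible k J' \<Longrightarrow>
       norm (f (\<Sum>i<k. x (M (J i))) - f (\<Sum>i<k. x (M (J' i)))) \<le> A * real k powr (1 / q)"
proof -
  have "omega_f f (2 * b) < \<infinity>" using f by (simp add: coarse_embedding_def)
  then obtain W where W: "omega_f f (2 * b) \<le> ereal W" by (cases "omega_f f (2 * b)") auto
  define lam where "lam = max 1 W"
  have fW: "norm (f u - f v) \<le> lam" if "norm (u - v) \<le> 2 * b" for u v
  proof -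
    have "ereal (norm (f (fst (u, v)) - f (snd (u, v)))) \<le> omega_f f (2 * b)"
      unfolding omega_f_def by (rule SUP_upper) (use that in simp)
    from order_trans[OF this W] show ?thesis by (simp add: lam_def)
  qed
  define F where "F k ns = f (\<Sum>n\<leftarrow>ns. x n)" for k :: nat and ns
  have lip: "coord_lipschitz lam k (F k)" for k
    unfolding coord_lipschitz_def F_def
  proof (intro allI impI fW)
    fix as bs m n
    show "norm ((\<Sum>n\<leftarrow>as @ m # bs. x n) - (\<Sum>n\<leftarrow>as @ n # bs. x n)) \<le> 2 * b"
      using norm_triangle_ineq4[of "x m" "x n"] x[of m] x[of n] by (simp add: algebra_simps)
  qed
  have lam: "lam > 0" by (simp add: lam_def)
  obtain K where K: "K > 0" and conc: "\<And>lam F. lam > 0 \<Longrightarrow> (\<And>k. coord_lipschitz lam k (F k :: nat list \<Rightarrow> 'b)) \<Longrightarrow>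
       \<exists>M y. strict_mono M \<and> (\<forall>k>0. \<forall>J. admissible k J \<longrightarrow>
         norm (F k (map (\<lambda>i. M (J i)) [0..<k]) - y k) \<le> K * lam * real k powr (1 / q))"
    using tuple_concentration[OF R S q] by metis
  obtain M y where M: "strict_mono M"
    and My: "\<And>k J. k > 0 \<Longrightarrow> admissible k J \<Longrightarrow>
         norm (F k (map (\<lambda>i. M (J i)) [0..<k]) - y k) \<le> K * lam * real k powr (1 / q)"
    using conc[OF lam lip] by blast
  have F: "F k (map (\<lambda>i. M (J i)) [0..<k]) = f (\<Sum>i<k. x (M (J i)))" for k J
    by (simp add: F_def interv_sum_list_conv_sum_set_nat o_def atLeast0LessThan)
  show ?thesis
  proof (rule that[OF M, of "2 * (K * lam)"])
    show "2 * (K * lam) > 0" using K lam by simp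
    show "norm (f (\<Sum>i<k. x (M (J i))) - f (\<Sum>i<k. x (M (J' i)))) \<le> 2 * (K * lam) * real k powr (1 / q)"
      if k: "k > 0" and J: "admissible k J" "admissible k J'" for k J J'
      using norm_triangle_ineq4[of "f (\<Sum>i<k. x (M (J i))) - y k" "f (\<Sum>i<k. x (M (J' i))) - y k"]
        My[OF k J(1)] My[OF k J(2)] unfolding F by simp
  qed
qed

section \<open>Compression exponents\<close>

text \<open>Since \<open>\<gamma> > 0\<close> gives \<open>real k powr \<gamma> \<ge> 1\<close>, the
  additive \<open>L\<close> is absorbed on the right; a larger exponent on the left would then win
  for large \<open>k\<close>.\<close>

lemma powr_growth_exponent_le:
  fixes \<beta> \<gamma> c A L :: real
  assumes c: "c > 0" and L: "L > 0" and A: "A > 0" and \<gamma>: "\<gamma> > 0"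
    and le: "\<And>k::nat. k > 0 \<Longrightarrow> c * real k powr \<beta> / L - L \<le> A * real k powr \<gamma>"
  shows "\<beta> \<le> \<gamma>"
proof (rule ccontr)
  assume "\<not> \<beta> \<le> \<gamma>"
  define \<delta> where "\<delta> = \<beta> - \<gamma>"
  have \<delta>: "\<delta> > 0" using \<open>\<not> \<beta> \<le> \<gamma>\<close> by (simp add: \<delta>_def)
  \<comment> \<open>The bound that \<open>real k powr \<delta>\<close> would have to obey for every
    positive \<open>k\<close>.\<close>
  define D where "D = L * (A + L) / c"
  have D: "D > 0" using c L A by (simp add: D_def)
  obtain k :: nat where k: "real k > max 1 (D powr (1 / \<delta>))" using reals_Archimedean2 by blast
  then have k0: "k > 0" "real k > 1" by auto
  have "1 \<le> real k powr \<gamma>" using k0 \<gamma> by (simp add: ge_one_powr_ge_zero)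
  then have "c * real k powr \<beta> / L \<le> (A + L) * real k powr \<gamma>"
    using le[OF k0(1)] L mult_left_mono[of 1 "real k powr \<gamma>" L] unfolding distrib_right by linarith
  then have "c * real k powr \<beta> \<le> L * (A + L) * real k powr \<gamma>"
    using L by (simp add: field_simps)
  moreover have "real k powr \<beta> = real k powr \<delta> * real k powr \<gamma>"
    by (simp add: \<delta>_def powr_add[symmetric])
  ultimately have "(c * real k powr \<delta>) * real k powr \<gamma> \<le> (L * (A + L)) * real k powr \<gamma>"
    by (simp add: mult.assoc)
  then have "c * real k powr \<delta> \<le> L * (A + L)" using k0 by simp
  then have "real k powr \<delta> \<le> D" using c by (simp add: D_def field_simps)
  moreover have "(D powr (1 / \<delta>)) powr \<delta> < real k powr \<delta>"
    using k \<delta> by (intro powr_less_mono2) auto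
  ultimately show False using D \<delta> by (simp add: powr_powr)
qed

text \<open>Common endgame of both cases: points at distance of order at least
  \<open>real k powr \<beta>\<close> whose images are only of order
  \<open>real k powr (1 / q)\<close> apart.\<close>

lemma compression_exponent_bound:
  fixes f :: "'a::real_normed_vector \<Rightarrow> 'b::real_normed_vector"
  assumes q: "q > 0" and \<alpha>: "\<alpha> > 0" and c: "c > 0" and L: "L > 0" and A: "A > 0"
    and f: "\<And>x y. norm (f x - f y) \<ge> norm (x - y) powr \<alpha> / L - L"
    and up: "\<And>k::nat. k > 0 \<Longrightarrow> norm (f (u k) - f (v k)) \<le> A * real k powr (1 / q)"
    and low: "\<And>k::nat. k > 0 \<Longrightarrow> c * real k powr \<beta> \<le> norm (u k - v k)"
  shows "\<alpha> * \<beta> \<le> 1 / q"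
proof (rule powr_growth_exponent_le[of "c powr \<alpha>" L A])
  fix k :: nat assume k: "k > 0"
  have "c powr \<alpha> * real k powr (\<alpha> * \<beta>) = (c * real k powr \<beta>) powr \<alpha>"
    using c k by (simp add: powr_mult powr_powr mult.commute)
  also have "\<dots> \<le> norm (u k - v k) powr \<alpha>"
    using low[OF k] \<alpha> c by (intro powr_mono2) auto
  finally have "c powr \<alpha> * real k powr (\<alpha> * \<beta>) / L \<le> norm (u k - v k) powr \<alpha> / L"
    using L by (simp add: divide_right_mono)
  then show "c powr \<alpha> * real k powr (\<alpha> * \<beta>) / L - L \<le> A * real k powr (1 / q)"
    using f[of "u k" "v k"] up[OF k] by linarith
qed (use assms in auto)

lemma compression_exponent_le:
  assumes "r \<ge> 0"
    and "\<And>\<alpha> L (f :: 'a::real_normed_vector \<Rightarrow> 'b::real_normed_vector). \<alpha> > 0 \<Longrightarrow> coarse_embedding f \<Longrightarrow> L > 0 \<Longrightarrow>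
       (\<And>x y. norm (f x - f y) \<ge> norm (x - y) powr \<alpha> / L - L) \<Longrightarrow> \<alpha> \<le> r"
  shows "compression_exponent TYPE('a) TYPE('b) \<le> ereal r"
  unfolding compression_exponent_def
  by (rule Sup_least) (use assms in auto)

text \<open>The exponent 1 is itself admissible, so any upper bound below 1 on the compression
  exponent excludes coarse Lipschitz embeddings.\<close>

lemma coarse_lipschitz_compression_exponent:
  fixes f :: "'a::real_normed_vector \<Rightarrow> 'b::real_normed_vector"
  assumes "coarse_lipschitz_embedding f"
  shows "compression_exponent TYPE('a) TYPE('b) \<ge> 1"
proof -
  obtain L where L: "L > 0" and om: "\<And>t. t \<ge> 0 \<Longrightarrow> omega_f f t \<le> ereal (L * t + L)"
    and rh: "\<And>t. t \<ge> 0 \<Longrightarrow> rho_f f t \<ge> ereal (t / L - L)"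
    using assms by (auto simp: coarse_lipschitz_embedding_def)
  \<comment> \<open>The assumed bound covers \<open>t \<ge> 0\<close> only; monotonicity of
    \<open>omega_f\<close> handles negative \<open>t\<close>.\<close>
  have "omega_f f t < \<infinity>" for t
  proof -
    have "omega_f f t \<le> omega_f f (max 0 t)"
      unfolding omega_f_def by (rule SUP_subset_mono) auto
    also have "\<dots> \<le> ereal (L * max 0 t + L)" by (rule om) simp
    also have "\<dots> < \<infinity>" by simp
    finally show ?thesis .
  qed
  moreover have "((\<lambda>t. rho_f f t) \<longlongrightarrow> \<infinity>) at_top"
    unfolding tendsto_PInfty
  proof
    fix r :: real
    have "eventually (\<lambda>t. t > max 0 (L * (r + L))) at_top" by (rule eventually_gt_at_top)
    then show "eventually (\<lambda>t. ereal r < rho_f f t) at_top"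
    proof eventually_elim
      case (elim t)
      then have "r < t / L - L" using L by (simp add: field_simps)
      then have "ereal r < ereal (t / L - L)" by simp
      also have "\<dots> \<le> rho_f f t" using elim by (intro rh) simp
      finally show ?case .
    qed
  qed
  moreover have "norm (f x - f y) \<ge> norm (x - y) powr 1 / L - L" for x y
  proof -
    have "rho_f f (norm (x - y)) \<le> ereal (norm (f (fst (x, y)) - f (snd (x, y))))"
      unfolding rho_f_def by (rule INF_lower) simp
    from order_trans[OF rh this] show ?thesis by simp
  qed
  ultimately have "1 \<in> {\<alpha>::real. \<alpha> > 0 \<and> (\<exists>f::'a \<Rightarrow> 'b. coarse_embedding f \<and>
           (\<exists>L>0. \<forall>x y. norm (f x - f y) \<ge> norm (x - y) powr \<alpha> / L - L))}"
    using L by (auto simp: coarse_embedding_def)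
  then show ?thesis
    unfolding compression_exponent_def one_ereal_def by (intro Sup_upper insertI2 imageI)
qed

section \<open>Spaces with an asymptotically l1 sequence\<close>

lemma sum_lessThan_add:
  fixes g :: "nat \<Rightarrow> 'a::comm_monoid_add"
  shows "(\<Sum>j<m + n. g j) = (\<Sum>j<m. g j) + (\<Sum>j<n. g (m + j))"
  by (induction n) (simp_all add: add.assoc)

text \<open>Coefficients 1 on the first \<open>k\<close> and -1 on the last \<open>k\<close> of
  \<open>2 * k\<close> late indices make the l1 lower estimate linear in \<open>k\<close>.\<close>

lemma compression_asymp_l1:
  fixes f :: "'a::real_normed_vector \<Rightarrow> 'b::banach" and x :: "nat \<Rightarrow> 'a"
  assumes R: "reflexive_space TYPE('b)" and S: "asymp_q_uniformly_smooth q TYPE('b)" and q: "q > 0"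
    and x: "asymp_l1_seq x"
    and \<alpha>: "\<alpha> > 0" and f: "coarse_embedding f" and L: "L > 0"
    and fL: "\<And>x y. norm (f x - f y) \<ge> norm (x - y) powr \<alpha> / L - L"
  shows "\<alpha> \<le> 1 / q"
proof -
  obtain D where D: "D > 0" and "\<forall>m. \<exists>k. \<forall>n::nat \<Rightarrow> nat.
        ((\<forall>j<m. k \<le> n j) \<and> (\<forall>j. Suc j < m \<longrightarrow> n j < n (Suc j))) \<longrightarrow>
        (\<forall>a::nat \<Rightarrow> real.
           (1 / D) * (\<Sum>j<m. \<bar>a j\<bar>) \<le> norm (\<Sum>j<m. a j *\<^sub>R x (n j)) \<and>
           norm (\<Sum>j<m. a j *\<^sub>R x (n j)) \<le> D * (\<Sum>j<m. \<bar>a j\<bar>))"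
    using x unfolding asymp_l1_seq_def by blast
  from choice[OF this(2)] obtain N
    where l1: "\<And>m n a. (\<forall>j<m. N m \<le> n j) \<Longrightarrow> (\<forall>j. Suc j < m \<longrightarrow> n j < n (Suc j)) \<Longrightarrow>
        (1 / D) * (\<Sum>j<m. \<bar>a j\<bar>) \<le> norm (\<Sum>j<m. a j *\<^sub>R x (n j)) \<and>
        norm (\<Sum>j<m. a j *\<^sub>R x (n j)) \<le> D * (\<Sum>j<m. \<bar>a j\<bar>)"
    by blast
  \<comment> \<open>The l1 estimate for one-term sums bounds the norms only from index
    \<open>N 1\<close> on; the shift makes the whole sequence bounded.\<close>
  define x' where "x' n = x (n + N 1)" for n
  have "norm (x' n) \<le> D" for n
    using l1[of 1 "\<lambda>_. n + N 1" "\<lambda>_. 1"] by (simp add: x'_def)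
  then obtain M A where M: "strict_mono M" and A: "A > 0"
    and conc: "\<And>k J J'. k > 0 \<Longrightarrow> admissible k J \<Longrightarrow> admissible k J' \<Longrightarrow>
       norm (f (\<Sum>i<k. x' (M (J i))) - f (\<Sum>i<k. x' (M (J' i)))) \<le> A * real k powr (1 / q)"
    using coarse_concentration[OF R S q f, of x' D] by metis
  \<comment> \<open>The offset \<open>k\<close> gives admissibility, the offset
    \<open>N (2 * k)\<close> the l1 estimate for all \<open>2 * k\<close> indices together.\<close>
  define J where "J k i = k + N (2 * k) + i" for k i
  define u where "u k = (\<Sum>i<k. x' (M (J k i)))" for k
  define v where "v k = (\<Sum>i<k. x' (M (J k (k + i))))" for k
  have "\<alpha> * 1 \<le> 1 / q"
  proof (rule compression_exponent_bound[OF q \<alpha> _ L A fL, of "2 / D" u v])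
    show "2 / D > 0" using D by simp
    fix k :: nat assume k: "k > 0"
    show "norm (f (u k) - f (v k)) \<le> A * real k powr (1 / q)"
      unfolding u_def v_def by (rule conc[OF k]) (auto simp: admissible_def J_def)
    define a where "a j = (if j < k then 1 else - 1 :: real)" for j
    let ?g = "\<lambda>j. a j *\<^sub>R x (M (J k j) + N 1)"
    have "(\<Sum>j<2 * k. ?g j) = (\<Sum>j<k. ?g j) + (\<Sum>j<k. ?g (k + j))"
      unfolding mult_2 by (rule sum_lessThan_add)
    also have "\<dots> = u k - v k"
      by (simp add: a_def u_def v_def x'_def sum_negf)
    finally have eq: "(\<Sum>j<2 * k. ?g j) = u k - v k" .
    have "N (2 * k) \<le> M (J k j) + N 1" for j
      using strict_mono_imp_increasing[OF M, of "J k j"] by (simp add: J_def)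
    moreover have "M (J k j) + N 1 < M (J k (Suc j)) + N 1" for j
      using M by (simp add: strict_mono_less J_def)
    ultimately have "(1 / D) * (\<Sum>j<2 * k. \<bar>a j\<bar>) \<le> norm (u k - v k)"
      using l1[of "2 * k" "\<lambda>j. M (J k j) + N 1" a] unfolding eq by blast
    moreover have "(\<Sum>j<2 * k. \<bar>a j\<bar>) = 2 * real k" by (simp add: a_def abs_if if_distrib cong: if_cong)
    ultimately show "2 / D * real k powr 1 \<le> norm (u k - v k)" using k by simp
  qed
  then show ?thesis by simp
qed

section \<open>Infinite-dimensional spaces with the co-Banach-Saks property\<close>

lemma riesz_separated_vector:
  fixes S :: "'a::banach set"
  assumes "infinite_dimensional TYPE('a)" and S: "finite S"
  shows "\<exists>v. norm v \<le> 2 \<and> (\<forall>w\<in>S. 1 \<le> norm (v - w))"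
proof -
  obtain v where v: "v \<notin> span S" using assms unfolding infinite_dimensional_def by blast
  define d where "d = infdist v (span S)"
  have ne: "span S \<noteq> {}" using span_zero by blast
  have d: "d > 0"
    unfolding d_def using v ne closed_span_finite[OF S] by (intro infdist_pos_not_in_closed)
  \<comment> \<open>Riesz's lemma: a nearly closest point \<open>e\<close> is subtracted and the
    difference is scaled by \<open>1 / d\<close>. The factor 2 becomes the norm bound.\<close>
  have "\<exists>e\<in>span S. dist v e < 2 * d"
  proof (rule ccontr)
    assume "\<not> ?thesis"
    then have "2 * d \<le> infdist v (span S)"
      unfolding infdist_notempty[OF ne] by (intro cINF_greatest ne) (auto simp: not_less)
    then show False using d by (simp add: d_def)
  qed
  then obtain e where e: "e \<in> span S" "dist v e < 2 * d" by blast
  have "1 \<le> norm ((1 / d) *\<^sub>R (v - e) - w)" if "w \<in> S" for w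
  proof -
    have "e + d *\<^sub>R w \<in> span S" using e(1) by (intro span_add span_scale[OF span_base[OF that]])
    then have "d \<le> norm (v - (e + d *\<^sub>R w))" unfolding d_def dist_norm[symmetric] by (rule infdist_le)
    also have "v - (e + d *\<^sub>R w) = d *\<^sub>R ((1 / d) *\<^sub>R (v - e) - w)"
      using d by (simp add: scaleR_diff_right)
    finally show ?thesis using d by simp
  qed
  moreover have "norm ((1 / d) *\<^sub>R (v - e)) \<le> 2" using e d by (simp add: dist_norm divide_le_eq del: scaleR_diff_right)
  ultimately show ?thesis by blast
qed

lemma compression_co_banach_saks:
  fixes f :: "'a::banach \<Rightarrow> 'b::banach"
  assumes R: "reflexive_space TYPE('b)" and S: "asymp_q_uniformly_smooth q TYPE('b)" and q: "q > 0"
    and p: "p \<ge> 1" and inf: "infinite_dimensional TYPE('a)" and bs: "co_banach_saks p TYPE('a)"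
    and \<alpha>: "\<alpha> > 0" and f: "coarse_embedding f" and L: "L > 0"
    and fL: "\<And>x y. norm (f x - f y) \<ge> norm (x - y) powr \<alpha> / L - L"
  shows "\<alpha> \<le> p / q"
proof -
  obtain x :: "nat \<Rightarrow> 'a"
    where x: "\<And>n. norm (x n) \<le> 2 \<and> (\<forall>w\<in>x ` {..<n}. 1 \<le> norm (x n - w))"
    by (rule finite_prefix_choice[of "\<lambda>_ S v. norm v \<le> 2 \<and> (\<forall>w\<in>S. 1 \<le> norm (v - w))"])
      (use riesz_separated_vector[OF inf] in blast)+
  then have x2: "\<And>n. norm (x n) \<le> 2" by blast
  obtain M A where M: "strict_mono M" and A: "A > 0"
    and conc: "\<And>k J J'. k > 0 \<Longrightarrow> admissible k J \<Longrightarrow> admissible k J' \<Longrightarrow>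
       norm (f (\<Sum>i<k. x (M (J i))) - f (\<Sum>i<k. x (M (J' i)))) \<le> A * real k powr (1 / q)"
    using coarse_concentration[OF R S q f, of x 2] x2 by metis
  \<comment> \<open>Disjoint pairs of neighbours: a sum of terms of \<open>z\<close> along
    increasing indices is a difference of sums of \<open>x\<close> over two admissible
    tuples.\<close>
  define z where "z j = x (M (Suc (2 * j))) - x (M (2 * j))" for j
  \<comment> \<open>Each case below only has to supply a growth exponent: \<open>1 / p\<close> from
    the co-Banach-Saks property, 1 from a functional.\<close>
  have bound: "\<alpha> * \<beta> \<le> 1 / q"
    if \<sigma>: "strict_mono \<sigma>" and c: "c > 0"
      and low: "\<And>k. k > 0 \<Longrightarrow> c * real k powr \<beta> \<le> norm (\<Sum>i<k. z (\<sigma> (k + i)))" for \<sigma> c \<beta>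
  proof (rule compression_exponent_bound[OF q \<alpha> c L A fL])
    fix k :: nat assume k: "k > 0"
    have "k \<le> 2 * \<sigma> (k + i)" for i using strict_mono_imp_increasing[OF \<sigma>, of "k + i"] by simp
    then have adm: "admissible k (\<lambda>i. 2 * \<sigma> (k + i))" "admissible k (\<lambda>i. Suc (2 * \<sigma> (k + i)))"
      using \<sigma> by (auto simp: admissible_def strict_mono_less intro: le_SucI)
    show "norm (f (\<Sum>i<k. x (M (Suc (2 * \<sigma> (k + i))))) - f (\<Sum>i<k. x (M (2 * \<sigma> (k + i)))))
        \<le> A * real k powr (1 / q)"
      by (rule conc[OF k adm(2,1)])
    show "c * real k powr \<beta> \<le> norm ((\<Sum>i<k. x (M (Suc (2 * \<sigma> (k + i))))) - (\<Sum>i<k. x (M (2 * \<sigma> (k + i)))))"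
      using low[OF k] by (simp add: z_def sum_subtractf)
  qed
  show ?thesis
  proof (cases "weakly_null z")
    case True
    have "1 \<le> norm (z j)" for j
    proof -
      have "M (2 * j) < M (Suc (2 * j))" using M by (simp add: strict_mono_less)
      then show ?thesis using x[of "M (Suc (2 * j))"] by (simp add: z_def)
    qed
    moreover have "norm (z j) \<le> 4" for j
      unfolding z_def
      using norm_triangle_ineq4[of "x (M (Suc (2 * j)))" "x (M (2 * j))"] x2[of "M (Suc (2 * j))"]
        x2[of "M (2 * j)"] by linarith
    ultimately have "semi_normalized z"
      unfolding semi_normalized_def by (intro exI[of _ 1] exI[of _ 4]) auto
    then obtain \<sigma> c where \<sigma>: "strict_mono \<sigma>" and c: "c > 0"
      and co: "\<And>k J. (\<forall>i<k. k \<le> J i) \<and> (\<forall>i. Suc i < k \<longrightarrow> J i < J (Suc i)) \<Longrightarrow>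
           norm (\<Sum>i<k. z (\<sigma> (J i))) \<ge> c * real k powr (1 / p)"
      using bs True unfolding co_banach_saks_def by metis
    have "\<alpha> * (1 / p) \<le> 1 / q"
      by (rule bound[OF \<sigma> c co]) auto
    then show ?thesis using p q by (simp add: field_simps)
  next
    case False
    then obtain g :: "'a \<Rightarrow>\<^sub>L real" where "\<not> (\<lambda>j. blinfun_apply g (z j)) \<longlonglongrightarrow> 0"
      by (auto simp: weakly_null_def)
    then obtain e where e: "e > 0" and fr: "\<And>n. \<exists>j\<ge>n. e \<le> \<bar>blinfun_apply g (z j)\<bar>"
      unfolding LIMSEQ_iff by (auto simp: not_less)
    \<comment> \<open>Passing to \<open>- g\<close> if necessary removes the absolute value on
      infinitely many indices, so the values add up without cancellation.\<close>
    let ?I = "\<lambda>g. {j. e \<le> blinfun_apply g (z j)}"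
    have "infinite {j. e \<le> \<bar>blinfun_apply g (z j)\<bar>}"
      using fr unfolding infinite_nat_iff_unbounded_le by auto
    moreover have "{j. e \<le> \<bar>blinfun_apply g (z j)\<bar>} \<subseteq> ?I g \<union> ?I (- g)"
      by (auto simp: abs_if blinfun.minus_left split: if_splits)
    ultimately have "infinite (?I g) \<or> infinite (?I (- g))"
      using finite_subset by blast
    then obtain g' where inf': "infinite (?I g')" by blast
    define \<sigma> where "\<sigma> = enumerate (?I g')"
    have \<sigma>: "strict_mono \<sigma>" unfolding \<sigma>_def using inf' by (rule strict_mono_enumerate)
    have ge: "e \<le> blinfun_apply g' (z (\<sigma> j))" for j
      using enumerate_in_set[OF inf', of j] by (simp add: \<sigma>_def)
    have "\<alpha> * 1 \<le> 1 / q"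
    proof (rule bound[OF \<sigma>])
      \<comment> \<open>Adding 1 keeps the denominator positive without a separate argument that
        \<open>g'\<close> is nonzero.\<close>
      show "e / (norm g' + 1) > 0" using e by (simp add: add_nonneg_pos)
      fix k :: nat assume "k > 0"
      have "real k * e = (\<Sum>i<k. e)" by simp
      also have "\<dots> \<le> (\<Sum>i<k. blinfun_apply g' (z (\<sigma> (k + i))))" by (intro sum_mono ge)
      also have "\<dots> = blinfun_apply g' (\<Sum>i<k. z (\<sigma> (k + i)))" by (simp add: blinfun.sum_right)
      also have "\<dots> \<le> norm g' * norm (\<Sum>i<k. z (\<sigma> (k + i)))"
        using norm_blinfun[of g'] by (metis abs_le_D1 real_norm_def)
      also have "\<dots> \<le> (norm g' + 1) * norm (\<Sum>i<k. z (\<sigma> (k + i)))" by (intro mult_right_mono) auto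
      finally have "real k * e \<le> (norm g' + 1) * norm (\<Sum>i<k. z (\<sigma> (k + i)))" .
      moreover have "norm g' + 1 > 0" by (simp add: add_nonneg_pos)
      ultimately show "e / (norm g' + 1) * real k powr 1 \<le> norm (\<Sum>i<k. z (\<sigma> (k + i)))"
        by (simp add: divide_le_eq mult_ac)
    qed
    also have "\<dots> \<le> p / q" using p q by (simp add: divide_right_mono)
    finally show ?thesis by simp
  qed
qed

theorem theorem4p3:
  fixes p q :: real
  assumes "1 < p" and "p < q"
    and "reflexive_space TYPE('b::banach)"
    and "asymp_q_uniformly_smooth q TYPE('b)"
  shows "((\<exists>x::nat \<Rightarrow> 'a::banach. asymp_l1_seq x) \<longrightarrow>
            compression_exponent TYPE('a) TYPE('b) \<le> ereal (1 / q) \<and>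
            \<not> (\<exists>f::'a \<Rightarrow> 'b. coarse_lipschitz_embedding f))
       \<and> ((infinite_dimensional TYPE('a) \<and> co_banach_saks p TYPE('a) \<and>
             \<not> contains_l1 TYPE('a)) \<longrightarrow>
            compression_exponent TYPE('a) TYPE('b) \<le> ereal (p / q) \<and>
            \<not> (\<exists>f::'a \<Rightarrow> 'b. coarse_lipschitz_embedding f))"
proof -
  have q: "q > 0" "1 / q \<ge> 0" "1 / q < 1" "p / q \<ge> 0" "p / q < 1" using assms by auto
  \<comment> \<open>Both bounds \<open>1 / q\<close> and \<open>p / q\<close> lie below 1, whereas a
    coarse Lipschitz embedding forces the exponent to be at least 1.\<close>
  have no_CL: "\<not> (\<exists>f::'a \<Rightarrow> 'b. coarse_lipschitz_embedding f)"
    if "compression_exponent TYPE('a) TYPE('b) \<le> ereal r" "r < 1" for r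
  proof
    assume "\<exists>f::'a \<Rightarrow> 'b. coarse_lipschitz_embedding f"
    then have "1 \<le> compression_exponent TYPE('a) TYPE('b)"
      using coarse_lipschitz_compression_exponent by blast
    then have "1 \<le> ereal r" using that(1) by (rule order_trans)
    then show False using that(2) by (simp add: one_ereal_def)
  qed
  have 1: "compression_exponent TYPE('a) TYPE('b) \<le> ereal (1 / q)" if "asymp_l1_seq x" for x :: "nat \<Rightarrow> 'a"
    by (rule compression_exponent_le[OF q(2)])
      (rule compression_asymp_l1[OF assms(3,4) q(1) that])
  have 2: "compression_exponent TYPE('a) TYPE('b) \<le> ereal (p / q)"
    if "infinite_dimensional TYPE('a)" "co_banach_saks p TYPE('a)"
    by (rule compression_exponent_le[OF q(4)])
      (rule compression_co_banach_saks[OF assms(3,4) q(1) less_imp_le[OF assms(1)] that])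
  show ?thesis using 1 2 no_CL[OF _ q(3)] no_CL[OF _ q(5)] by blast
qed

end
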